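(* Let $M(c)$ be an $n$-dimensional space form of constant sectional curvature $c$, with $n\ge 3$, and let $\alpha: I\to M(c)$ be an $n$-th order regular curve with unit tangent $v_1$, curvatures $k_1,\dots,k_{n-1}$ and harmonic curvatures $H_1,\dots,H_{n-2}$ (with $H_0=0$). Then $\alpha$ is an LC helix if and only if $$v_1[H_{n-2}]+k_{n-1}H_{n-3}=0$$ along $\alpha$.
   Context: Let $\nabla$ be the Levi-Civita connection of $M=M(c)$ and $\langle\cdot,\cdot\rangle$ its metric; $I\subset\mathbb{R}$ is an open interval. An $n$-th order regular (non-degenerate) curve $\alpha:I\to M$ is a smooth curve with an orthonormal Frenet frame $\{v_1,\dots,v_n\}$ of vector fields along $\alpha$ tangent to $M$, where $v_1$ is the unit tangent, and with nowhere vanishing curvatures $k_1,\dots,k_{n-1}$, such that $\nabla_{v_1}v_1=k_1v_2$, $\nabla_{v_1}v_i=-k_{i-1}v_{i-1}+k_iv_{i+1}$ for $1<i<n$, and $\nabla_{v_1}v_n=-k_{n-1}v_{n-1}$. For a function $f$ along $\alpha$, $v_1[f]$ denotes the derivative of $f$ with respect to arc length. Harmonic curvatures: $H_0=0$, $H_1=\dfrac{k_1}{k_2}$, and $H_i=\dfrac{1}{k_{i+1}}\left(v_1[H_{i-1}]+k_iH_{i-2}\right)$ for $1<i\le n-2$. A vector field $X$ along $\alpha$ tangent to $M$ is LC parallel (parallel in the sense of Levi-Civita) if $\nabla_{v_1}X=0$. The curve $\alpha$ is an LC helix if there is a unit LC parallel vector field $X$ along $\alpha$ such that $\langle v_1,X\rangle=\cos\varphi$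 is constant along $\alpha$; such an $X$ is called an axis of the LC helix. *)

theory Defs
  imports "HOL-Analysis.Analysis"
begin

section \<open>Smooth maps\<close>

text \<open>Only meaningful for open \<open>S\<close>.\<close>

primrec Ck_on :: "nat \<Rightarrow> ('a::real_normed_vector \<Rightarrow> 'b::real_normed_vector) \<Rightarrow> 'a set \<Rightarrow> bool" where
  "Ck_on 0 f S \<longleftrightarrow> continuous_on S f"
| "Ck_on (Suc m) f S \<longleftrightarrow> (\<forall>x\<in>S. f differentiable (at x)) \<and>
     (\<forall>v. Ck_on m (\<lambda>x. frechet_derivative f (at x) v) S)"

definition smooth_on :: "('a::real_normed_vector \<Rightarrow> 'b::real_normed_vector) \<Rightarrow> 'a set \<Rightarrow> bool" where
  "smooth_on f S \<longleftrightarrow> (\<forall>m. Ck_on m f S)"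


section \<open>Riemannian manifolds\<close>

text \<open>
  A chart is a pair of a domain and a coordinate map; the values of the map outside its domain
  are irrelevant. The metric is given by its Gram matrix in each chart, as a function of the
  coordinates. The dimension of the manifold is \<open>CARD('n)\<close>.
\<close>

type_synonym ('a, 'n) chart = "'a set \<times> ('a \<Rightarrow> real ^ 'n)"

record ('a, 'n::finite) riemannian =
  topo :: "'a topology"
  atlas :: "('a, 'n) chart set"
  gram :: "('a, 'n) chart \<Rightarrow> real ^ 'n \<Rightarrow> real ^ 'n ^ 'n"

abbreviation chart_dom :: "('a, 'n) chart \<Rightarrow> 'a set" where "chart_dom \<equiv> fst"
abbreviation coords :: "('a, 'n) chart \<Rightarrow> 'a \<Rightarrow> real ^ 'n" where "coords \<equiv> snd"

abbreviation chart_image :: "('a, 'n) chart \<Rightarrow> (real ^ 'n) set" where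
  "chart_image \<phi> \<equiv> coords \<phi> ` chart_dom \<phi>"

definition is_chart :: "'a topology \<Rightarrow> ('a, 'n::finite) chart \<Rightarrow> bool" where
  "is_chart T \<phi> \<longleftrightarrow> openin T (chart_dom \<phi>) \<and> open (chart_image \<phi>) \<and>
     homeomorphic_map (subtopology T (chart_dom \<phi>)) (top_of_set (chart_image \<phi>)) (coords \<phi>)"

definition transition :: "('a, 'n::finite) chart \<Rightarrow> ('a, 'n) chart \<Rightarrow> real ^ 'n \<Rightarrow> real ^ 'n" where
  "transition \<phi> \<psi> = coords \<psi> \<circ> inv_into (chart_dom \<phi>) (coords \<phi>)"

text \<open>
  The differential of the change of coordinates from \<open>\<phi>\<close> to \<open>\<psi>\<close> at the point \<open>p\<close>: it maps the
  components of a tangent vector at \<open>p\<close> in the chart \<open>\<phi>\<close> to its components in \<open>\<psi>\<close>.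
\<close>

definition change_comps ::
  "('a, 'n::finite) chart \<Rightarrow> ('a, 'n) chart \<Rightarrow> 'a \<Rightarrow> real ^ 'n \<Rightarrow> real ^ 'n" where
  "change_comps \<phi> \<psi> p = frechet_derivative (transition \<phi> \<psi>) (at (coords \<phi> p))"

definition smooth_manifold :: "('a, 'n::finite) riemannian \<Rightarrow> bool" where
  "smooth_manifold M \<longleftrightarrow>
     Hausdorff_space (topo M) \<and> second_countable (topo M) \<and>
     (\<forall>\<phi>\<in>atlas M. is_chart (topo M) \<phi>) \<and>
     (\<Union>\<phi>\<in>atlas M. chart_dom \<phi>) = topspace (topo M) \<and>
     (\<forall>\<phi>\<in>atlas M. \<forall>\<psi>\<in>atlas M.
        smooth_on (transition \<phi> \<psi>) (coords \<phi> ` (chart_dom \<phi> \<inter> chart_dom \<psi>)))"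

text \<open>The inner product of the tangent vectors at \<open>p\<close> with components \<open>u\<close> and \<open>w\<close> in \<open>\<phi>\<close>.\<close>

definition inner_at ::
  "('a, 'n::finite) riemannian \<Rightarrow> ('a, 'n) chart \<Rightarrow> 'a \<Rightarrow> real ^ 'n \<Rightarrow> real ^ 'n \<Rightarrow> real" where
  "inner_at M \<phi> p u w = u \<bullet> (gram M \<phi> (coords \<phi> p) *v w)"

definition riemannian_manifold :: "('a, 'n::finite) riemannian \<Rightarrow> bool" where
  "riemannian_manifold M \<longleftrightarrow> smooth_manifold M \<and>
     (\<forall>\<phi>\<in>atlas M. smooth_on (gram M \<phi>) (chart_image \<phi>)) \<and>
     (\<forall>\<phi>\<in>atlas M. \<forall>p\<in>chart_dom \<phi>. \<forall>u w. inner_at M \<phi> p u w = inner_at M \<phi> p w u) \<and>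
     (\<forall>\<phi>\<in>atlas M. \<forall>p\<in>chart_dom \<phi>. \<forall>u. u \<noteq> 0 \<longrightarrow> inner_at M \<phi> p u u > 0) \<and>
     (\<forall>\<phi>\<in>atlas M. \<forall>\<psi>\<in>atlas M. \<forall>p\<in>chart_dom \<phi> \<inter> chart_dom \<psi>. \<forall>u w.
        inner_at M \<phi> p u w
          = inner_at M \<psi> p (change_comps \<phi> \<psi> p u) (change_comps \<phi> \<psi> p w))"


section \<open>Levi-Civita connection and sectional curvature in coordinates\<close>

definition pd :: "'n \<Rightarrow> (real ^ 'n::finite \<Rightarrow> real) \<Rightarrow> real ^ 'n \<Rightarrow> real" where
  "pd i f x = frechet_derivative f (at x) (axis i 1)"

lemma pd_cong:
  assumes "open S" "x \<in> S" "\<And>y. y \<in> S \<Longrightarrow> f y = g y"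
  shows "pd i f x = pd i g x"
proof -
  have "(f has_derivative D) (at x) \<longleftrightarrow> (g has_derivative D) (at x)" for D
    using assms by (metis has_derivative_transform_within_open)
  then show ?thesis
    by (simp add: pd_def frechet_derivative_def)
qed

text \<open>\<open>christoffel G k i j\<close> is the symbol with upper index \<open>k\<close> and lower indices \<open>i\<close>, \<open>j\<close>.\<close>

definition christoffel ::
  "(real ^ 'n \<Rightarrow> real ^ 'n ^ 'n) \<Rightarrow> 'n::finite \<Rightarrow> 'n \<Rightarrow> 'n \<Rightarrow> real ^ 'n \<Rightarrow> real" where
  "christoffel G k i j x = 1/2 * (\<Sum>l\<in>UNIV. matrix_inv (G x) $ k $ l *
     (pd i (\<lambda>y. G y $ j $ l) x + pd j (\<lambda>y. G y $ i $ l) x - pd l (\<lambda>y. G y $ i $ j) x))"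

text \<open>
  The Christoffel symbols are the coefficients of the unique torsion-free metric connection.
\<close>

lemma christoffel_levi_civita:
  fixes G :: "real ^ 'n::finite \<Rightarrow> real ^ 'n ^ 'n"
  assumes sym: "\<And>y i j. y \<in> S \<Longrightarrow> G y $ i $ j = G y $ j $ i" and "open S" "x \<in> S"
    and inv: "invertible (G x)"
  shows "(\<forall>k i j. \<Gamma> k i j = christoffel G k i j x) \<longleftrightarrow>
    (\<forall>k i j. \<Gamma> k i j = \<Gamma> k j i) \<and>
    (\<forall>k i j. pd k (\<lambda>y. G y $ i $ j) x
       = (\<Sum>l\<in>UNIV. \<Gamma> l k i * G x $ l $ j) + (\<Sum>l\<in>UNIV. \<Gamma> l k j * G x $ i $ l))"
proof -
  define D where "D a b c = pd a (\<lambda>y. G y $ b $ c) x" for a b c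
  define E :: "'n \<Rightarrow> 'n \<Rightarrow> real ^ 'n" where "E i j = (\<chi> l. D i j l + D j i l - D l i j)" for i j
  define \<gamma> :: "'n \<Rightarrow> 'n \<Rightarrow> real ^ 'n" where "\<gamma> i j = (\<chi> k. \<Gamma> k i j)" for i j
  define L where "L m i j = (\<Sum>k\<in>UNIV. G x $ m $ k * \<Gamma> k i j)" for m i j
  have Dsym: "D a b c = D a c b" for a b c
    unfolding D_def by (rule pd_cong[of S]) (use assms in auto)
  have L: "G x *v \<gamma> i j = (\<chi> m. L m i j)" for i j
    by (simp add: L_def \<gamma>_def vec_eq_iff matrix_vector_mult_def)
  have inj: "G x *v u = G x *v w \<longleftrightarrow> u = w" for u w
    using inv by (metis invertible_def matrix_vector_mul_assoc matrix_vector_mul_lid)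
  have inv_right: "G x ** matrix_inv (G x) = mat 1"
    using someI_ex[OF inv[unfolded invertible_def]] by (simp add: matrix_inv_def)
  have "(\<forall>k. \<Gamma> k i j = christoffel G k i j x) \<longleftrightarrow> \<gamma> i j = (1/2) *\<^sub>R (matrix_inv (G x) *v E i j)" for i j
    by (simp add: christoffel_def E_def D_def \<gamma>_def vec_eq_iff matrix_vector_mult_def)
  also have "\<dots> i j \<longleftrightarrow> G x *v \<gamma> i j = (1/2) *\<^sub>R E i j" for i j
    by (subst inj[symmetric]) (simp add: inv_right matrix_vector_mul_assoc matrix_vector_mult_scaleR)
  also have "\<dots> i j \<longleftrightarrow> (\<forall>m. L m i j = (D i j m + D j i m - D m i j) / 2)" for i j
    by (auto simp: L E_def vec_eq_iff)
  finally have 1: "(\<forall>k. \<Gamma> k i j = christoffel G k i j x) \<longleftrightarrow>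
      (\<forall>m. L m i j = (D i j m + D j i m - D m i j) / 2)" for i j .
  have "(\<forall>k. \<Gamma> k i j = \<Gamma> k j i) \<longleftrightarrow> \<gamma> i j = \<gamma> j i" for i j
    by (simp add: \<gamma>_def vec_eq_iff)
  also have "\<dots> i j \<longleftrightarrow> (\<forall>m. L m i j = L m j i)" for i j
    by (subst inj[symmetric]) (simp add: L vec_eq_iff)
  finally have 2: "(\<forall>k. \<Gamma> k i j = \<Gamma> k j i) \<longleftrightarrow> (\<forall>m. L m i j = L m j i)" for i j .
  have 3: "(\<Sum>l\<in>UNIV. \<Gamma> l k i * G x $ l $ j) = L j k i"
    "(\<Sum>l\<in>UNIV. \<Gamma> l k j * G x $ i $ l) = L i k j" for k i j
    unfolding L_def by (simp_all add: sym[OF \<open>x \<in> S\<close>, of _ j] mult.commute)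
  have "(\<forall>i j m. L m i j = (D i j m + D j i m - D m i j) / 2) \<longleftrightarrow>
      (\<forall>i j m. L m i j = L m j i) \<and> (\<forall>k i j. D k i j = L j k i + L i k j)" (is "?l \<longleftrightarrow> ?r")
  proof
    assume ?l
    then have l: "L m i j = (D i j m + D j i m - D m i j) / 2" for i j m
      by blast
    have "L m i j = L m j i" for m i j
      using Dsym[of m i j] by (simp add: l)
    moreover have "D k i j = L j k i + L i k j" for k i j
      using Dsym[of k i j] Dsym[of i k j] Dsym[of j k i] by (simp add: l field_simps)
    ultimately show ?r by blast
  next
    assume r: ?r
    show ?l
    proof (intro allI)
      fix i j m
      have "D i j m = L m i j + L j i m" "D j i m = L m j i + L i j m" "D m i j = L j m i + L i m j"
        "L m j i = L m i j" "L j i m = L j m i" "L i j m = L i m j"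
        using r by blast+
      then show "L m i j = (D i j m + D j i m - D m i j) / 2"
        by simp
    qed
  qed
  moreover have "(\<forall>k i j. \<Gamma> k i j = christoffel G k i j x) \<longleftrightarrow>
      (\<forall>i j m. L m i j = (D i j m + D j i m - D m i j) / 2)"
    using 1 by blast
  moreover have "(\<forall>k i j. \<Gamma> k i j = \<Gamma> k j i) \<longleftrightarrow> (\<forall>i j m. L m i j = L m j i)"
    using 2 by blast
  ultimately show ?thesis
    unfolding 3 D_def[symmetric] by simp
qed

text \<open>
  Components of \<open>R(\<partial>\<^sub>i,\<partial>\<^sub>j)\<partial>\<^sub>k\<close>, for
  \<open>R(X,Y)Z = \<nabla>\<^sub>X\<nabla>\<^sub>YZ - \<nabla>\<^sub>Y\<nabla>\<^sub>XZ - \<nabla>\<^bsub>[X,Y]\<^esub>Z\<close>; \<open>l\<close> is the upper index.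
\<close>

definition riem_comp ::
  "(real ^ 'n \<Rightarrow> real ^ 'n ^ 'n) \<Rightarrow> 'n::finite \<Rightarrow> 'n \<Rightarrow> 'n \<Rightarrow> 'n \<Rightarrow> real ^ 'n \<Rightarrow> real" where
  "riem_comp G l i j k x =
     pd i (christoffel G l j k) x - pd j (christoffel G l i k) x
     + (\<Sum>m\<in>UNIV. christoffel G l i m x * christoffel G m j k x)
     - (\<Sum>m\<in>UNIV. christoffel G l j m x * christoffel G m i k x)"

definition riem_tensor ::
  "(real ^ 'n \<Rightarrow> real ^ 'n ^ 'n) \<Rightarrow> real ^ 'n::finite \<Rightarrow> real ^ 'n \<Rightarrow> real ^ 'n \<Rightarrow> real ^ 'n \<Rightarrow> real ^ 'n" where
  "riem_tensor G x u v w =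
     (\<chi> l. \<Sum>i\<in>UNIV. \<Sum>j\<in>UNIV. \<Sum>k\<in>UNIV. riem_comp G l i j k x * u $ i * v $ j * w $ k)"

definition sectional_curvature ::
  "('a, 'n::finite) riemannian \<Rightarrow> ('a, 'n) chart \<Rightarrow> 'a \<Rightarrow> real ^ 'n \<Rightarrow> real ^ 'n \<Rightarrow> real" where
  "sectional_curvature M \<phi> p u v =
     inner_at M \<phi> p (riem_tensor (gram M \<phi>) (coords \<phi> p) u v v) u /
     (inner_at M \<phi> p u u * inner_at M \<phi> p v v - (inner_at M \<phi> p u v)\<^sup>2)"

definition constant_curvature :: "('a, 'n::finite) riemannian \<Rightarrow> real \<Rightarrow> bool" where
  "constant_curvature M c \<longleftrightarrow>
     (\<forall>\<phi>\<in>atlas M. \<forall>p\<in>chart_dom \<phi>. \<forall>u v. u \<noteq> v \<and> independent {u, v} \<longrightarrow>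
        sectional_curvature M \<phi> p u v = c)"


section \<open>Vector fields along curves\<close>

definition smooth_curve :: "('a, 'n::finite) riemannian \<Rightarrow> real set \<Rightarrow> (real \<Rightarrow> 'a) \<Rightarrow> bool" where
  "smooth_curve M I \<alpha> \<longleftrightarrow> continuous_map (top_of_set I) (topo M) \<alpha> \<and>
     (\<forall>\<phi>\<in>atlas M. smooth_on (\<lambda>t. coords \<phi> (\<alpha> t)) {t\<in>I. \<alpha> t \<in> chart_dom \<phi>})"

text \<open>
  A field of tangent vectors along \<open>\<alpha>\<close> is given by its components in each chart. The components
  in \<open>\<phi>\<close> at the parameter \<open>t\<close> matter only if \<open>\<alpha> t\<close> lies in the domain of \<open>\<phi>\<close>.
\<close>

type_synonym ('a, 'n) field_along = "('a, 'n) chart \<Rightarrow> real \<Rightarrow> real ^ 'n"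

definition vector_field_along ::
  "('a, 'n::finite) riemannian \<Rightarrow> real set \<Rightarrow> (real \<Rightarrow> 'a) \<Rightarrow> ('a, 'n) field_along \<Rightarrow> bool" where
  "vector_field_along M I \<alpha> X \<longleftrightarrow>
     (\<forall>\<phi>\<in>atlas M. smooth_on (X \<phi>) {t\<in>I. \<alpha> t \<in> chart_dom \<phi>}) \<and>
     (\<forall>\<phi>\<in>atlas M. \<forall>\<psi>\<in>atlas M. \<forall>t\<in>I. \<alpha> t \<in> chart_dom \<phi> \<inter> chart_dom \<psi> \<longrightarrow>
        X \<psi> t = change_comps \<phi> \<psi> (\<alpha> t) (X \<phi> t))"

definition field_eq ::
  "('a, 'n::finite) riemannian \<Rightarrow> real set \<Rightarrow> (real \<Rightarrow> 'a) \<Rightarrow>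
     ('a, 'n) field_along \<Rightarrow> ('a, 'n) field_along \<Rightarrow> bool" where
  "field_eq M I \<alpha> X Y \<longleftrightarrow>
     (\<forall>\<phi>\<in>atlas M. \<forall>t\<in>I. \<alpha> t \<in> chart_dom \<phi> \<longrightarrow> X \<phi> t = Y \<phi> t)"

text \<open>The choice of the chart is immaterial, see \<open>inner_along_eq\<close>.\<close>

definition inner_along ::
  "('a, 'n::finite) riemannian \<Rightarrow> (real \<Rightarrow> 'a) \<Rightarrow>
     ('a, 'n) field_along \<Rightarrow> ('a, 'n) field_along \<Rightarrow> real \<Rightarrow> real" where
  "inner_along M \<alpha> X Y t =
     (let \<phi> = SOME \<phi>. \<phi> \<in> atlas M \<and> \<alpha> t \<in> chart_dom \<phi> in inner_at M \<phi> (\<alpha> t) (X \<phi> t) (Y \<phi> t))"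

lemma inner_along_eq:
  assumes "riemannian_manifold M" "vector_field_along M I \<alpha> X" "vector_field_along M I \<alpha> Y"
    and "\<phi> \<in> atlas M" "t \<in> I" "\<alpha> t \<in> chart_dom \<phi>"
  shows "inner_along M \<alpha> X Y t = inner_at M \<phi> (\<alpha> t) (X \<phi> t) (Y \<phi> t)"
proof -
  define \<psi> where "\<psi> = (SOME \<psi>. \<psi> \<in> atlas M \<and> \<alpha> t \<in> chart_dom \<psi>)"
  have \<psi>: "\<psi> \<in> atlas M" "\<alpha> t \<in> chart_dom \<psi>"
    using someI[of "\<lambda>\<psi>. \<psi> \<in> atlas M \<and> \<alpha> t \<in> chart_dom \<psi>" \<phi>] assms(4,6) by (auto simp: \<psi>_def)
  have "X \<psi> t = change_comps \<phi> \<psi> (\<alpha> t) (X \<phi> t)" "Y \<psi> t = change_comps \<phi> \<psi> (\<alpha> t) (Y \<phi> t)"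
    using assms(2-6) \<psi> unfolding vector_field_along_def by blast+
  moreover have "inner_at M \<phi> (\<alpha> t) u w
      = inner_at M \<psi> (\<alpha> t) (change_comps \<phi> \<psi> (\<alpha> t) u) (change_comps \<phi> \<psi> (\<alpha> t) w)" for u w
    using assms(1,4,6) \<psi> unfolding riemannian_manifold_def by blast
  ultimately show ?thesis
    by (simp only: inner_along_def Let_def \<psi>_def[symmetric])
qed

definition velocity :: "(real \<Rightarrow> 'a) \<Rightarrow> ('a, 'n::finite) field_along" where
  "velocity \<alpha> \<phi> t = vector_derivative (\<lambda>s. coords \<phi> (\<alpha> s)) (at t)"

definition cov_deriv ::
  "('a, 'n::finite) riemannian \<Rightarrow> (real \<Rightarrow> 'a) \<Rightarrow> ('a, 'n) field_along \<Rightarrow> ('a, 'n) field_along" where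
  "cov_deriv M \<alpha> X \<phi> t = vector_derivative (X \<phi>) (at t) +
     (\<chi> k. \<Sum>i\<in>UNIV. \<Sum>j\<in>UNIV.
        christoffel (gram M \<phi>) k i j (coords \<phi> (\<alpha> t)) * velocity \<alpha> \<phi> t $ i * X \<phi> t $ j)"


section \<open>Space forms\<close>

definition geodesic :: "('a, 'n::finite) riemannian \<Rightarrow> real set \<Rightarrow> (real \<Rightarrow> 'a) \<Rightarrow> bool" where
  "geodesic M I \<gamma> \<longleftrightarrow> smooth_curve M I \<gamma> \<and>
     field_eq M I \<gamma> (cov_deriv M \<gamma> (velocity \<gamma>)) (\<lambda>\<phi> t. 0)"

definition geodesically_complete :: "('a, 'n::finite) riemannian \<Rightarrow> bool" where
  "geodesically_complete M \<longleftrightarrow>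
     (\<forall>\<phi>\<in>atlas M. \<forall>p\<in>chart_dom \<phi>. \<forall>u. \<exists>\<gamma>.
        geodesic M UNIV \<gamma> \<and> \<gamma> 0 = p \<and> velocity \<gamma> \<phi> 0 = u)"

definition space_form :: "('a, 'n::finite) riemannian \<Rightarrow> real \<Rightarrow> bool" where
  "space_form M c \<longleftrightarrow> riemannian_manifold M \<and> connected_space (topo M) \<and>
     geodesically_complete M \<and> constant_curvature M c"


section \<open>Frenet curves and helices\<close>

text \<open>
  Curves need not be parametrized by arc length, hence the division by the speed in
  \<open>arc_deriv\<close> (the derivative \<open>v\<^sub>1[f]\<close>) and \<open>nabla_tangent\<close> (the derivative \<open>\<nabla>\<^sub>v\<^sub>1 X\<close>, with
  \<open>v\<^sub>1\<close> the unit tangent).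
\<close>

definition speed :: "('a, 'n::finite) riemannian \<Rightarrow> (real \<Rightarrow> 'a) \<Rightarrow> real \<Rightarrow> real" where
  "speed M \<alpha> t = sqrt (inner_along M \<alpha> (velocity \<alpha>) (velocity \<alpha>) t)"

definition unit_tangent ::
  "('a, 'n::finite) riemannian \<Rightarrow> (real \<Rightarrow> 'a) \<Rightarrow> ('a, 'n) field_along" where
  "unit_tangent M \<alpha> \<phi> t = velocity \<alpha> \<phi> t /\<^sub>R speed M \<alpha> t"

definition arc_deriv ::
  "('a, 'n::finite) riemannian \<Rightarrow> (real \<Rightarrow> 'a) \<Rightarrow> (real \<Rightarrow> real) \<Rightarrow> real \<Rightarrow> real" where
  "arc_deriv M \<alpha> f t = deriv f t / speed M \<alpha> t"

definition nabla_tangent ::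
  "('a, 'n::finite) riemannian \<Rightarrow> (real \<Rightarrow> 'a) \<Rightarrow> ('a, 'n) field_along \<Rightarrow> ('a, 'n) field_along" where
  "nabla_tangent M \<alpha> X \<phi> t = cov_deriv M \<alpha> X \<phi> t /\<^sub>R speed M \<alpha> t"

text \<open>
  A curve of order \<open>n = CARD('n)\<close> with Frenet frame \<open>v 1, \<dots>, v n\<close> and curvatures
  \<open>k 1, \<dots>, k (n - 1)\<close>; the values of \<open>v\<close> and \<open>k\<close> at other
  indices are irrelevant.
\<close>

definition regular_curve ::
  "('a, 'n::finite) riemannian \<Rightarrow> real set \<Rightarrow> (real \<Rightarrow> 'a) \<Rightarrow>
     (nat \<Rightarrow> ('a, 'n) field_along) \<Rightarrow> (nat \<Rightarrow> real \<Rightarrow> real) \<Rightarrow> bool" where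
  "regular_curve M I \<alpha> v k \<longleftrightarrow> (let n = CARD('n) in
     smooth_curve M I \<alpha> \<and>
     (\<forall>\<phi>\<in>atlas M. \<forall>t\<in>I. \<alpha> t \<in> chart_dom \<phi> \<longrightarrow> velocity \<alpha> \<phi> t \<noteq> 0) \<and>
     (\<forall>i\<in>{1..n}. vector_field_along M I \<alpha> (v i)) \<and>
     (\<forall>i\<in>{1..n}. \<forall>j\<in>{1..n}. \<forall>t\<in>I. inner_along M \<alpha> (v i) (v j) t = (if i = j then 1 else 0)) \<and>
     field_eq M I \<alpha> (v 1) (unit_tangent M \<alpha>) \<and>
     (\<forall>i\<in>{1..n-1}. smooth_on (k i) I \<and> (\<forall>t\<in>I. k i t \<noteq> 0)) \<and>
     field_eq M I \<alpha> (nabla_tangent M \<alpha> (v 1)) (\<lambda>\<phi> t. k 1 t *\<^sub>R v 2 \<phi> t) \<and>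
     (\<forall>i. 1 < i \<and> i < n \<longrightarrow> field_eq M I \<alpha> (nabla_tangent M \<alpha> (v i))
        (\<lambda>\<phi> t. - k (i-1) t *\<^sub>R v (i-1) \<phi> t + k i t *\<^sub>R v (i+1) \<phi> t)) \<and>
     field_eq M I \<alpha> (nabla_tangent M \<alpha> (v n)) (\<lambda>\<phi> t. - k (n-1) t *\<^sub>R v (n-1) \<phi> t))"

fun harmonic_curvature ::
  "('a, 'n::finite) riemannian \<Rightarrow> (real \<Rightarrow> 'a) \<Rightarrow> (nat \<Rightarrow> real \<Rightarrow> real) \<Rightarrow> nat \<Rightarrow> real \<Rightarrow> real" where
  "harmonic_curvature M \<alpha> k 0 = (\<lambda>t. 0)"
| "harmonic_curvature M \<alpha> k (Suc 0) = (\<lambda>t. k 1 t / k 2 t)"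
| "harmonic_curvature M \<alpha> k (Suc (Suc i)) = (\<lambda>t. 1 / k (i+3) t *
     (arc_deriv M \<alpha> (harmonic_curvature M \<alpha> k (Suc i)) t + k (i+2) t * harmonic_curvature M \<alpha> k i t))"

definition LC_parallel ::
  "('a, 'n::finite) riemannian \<Rightarrow> real set \<Rightarrow> (real \<Rightarrow> 'a) \<Rightarrow> ('a, 'n) field_along \<Rightarrow> bool" where
  "LC_parallel M I \<alpha> X \<longleftrightarrow> field_eq M I \<alpha> (nabla_tangent M \<alpha> X) (\<lambda>\<phi> t. 0)"

definition LC_helix :: "('a, 'n::finite) riemannian \<Rightarrow> real set \<Rightarrow> (real \<Rightarrow> 'a) \<Rightarrow> bool" where
  "LC_helix M I \<alpha> \<longleftrightarrow> (\<exists>X. vector_field_along M I \<alpha> X \<and>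
     (\<forall>t\<in>I. inner_along M \<alpha> X X t = 1) \<and> LC_parallel M I \<alpha> X \<and>
     (\<exists>\<theta>. \<forall>t\<in>I. inner_along M \<alpha> (unit_tangent M \<alpha>) X t = cos \<theta>))"

end

theory Submission
  imports Defs
begin

text \<open>
  Let \<open>X\<close> be a parallel field along the curve. The metric is parallel, so the Frenet equations turn
  into a linear system for the functions \<open>b\<^sub>i = \<langle>v\<^sub>i, X\<rangle>\<close>, namely
  \<open>v\<^sub>1[b\<^sub>i] = k\<^sub>i b\<^bsub>i+1\<^esub> - k\<^bsub>i-1\<^esub> b\<^bsub>i-1\<^esub>\<close>, where the terms with the curvatures
  \<open>k\<^sub>0\<close> and \<open>k\<^sub>n\<close> are absent (\<open>frenet_system_inner_prod\<close>). Conversely, every solution gives a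
  parallel field \<open>\<Sum> b\<^sub>i v\<^sub>i\<close> (\<open>LC_parallel_combination\<close>). Thus parallel fields and solutions of the system
  are the same thing.

  Since the curvatures do not vanish, the equations for \<open>i < n\<close> determine \<open>b\<^sub>2, \<dots>, b\<^sub>n\<close> from \<open>b\<^sub>1\<close>. If
  \<open>b\<^sub>1\<close> is the constant \<open>1\<close>, this recursion is the definition of the harmonic curvatures: it gives
  \<open>b\<^sub>2 = 0\<close> and \<open>b\<^bsub>i+2\<^esub> = H\<^sub>i\<close>. The equation for \<open>i = n\<close>, which the recursion leaves over, then
  reads \<open>v\<^sub>1[H\<^bsub>n-2\<^esub>] + k\<^bsub>n-1\<^esub> H\<^bsub>n-3\<^esub> = 0\<close> (\<open>frenet_system_axis_coeff\<close>). This is the condition of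
  the theorem: it says that \<open>v\<^sub>1 + \<Sum> H\<^sub>i v\<^bsub>i+2\<^esub>\<close> is parallel.

  If \<open>X\<close> is the axis of a helix with \<open>\<langle>v\<^sub>1, X\<rangle> = cos \<theta>\<close>, its coefficients are \<open>cos \<theta>\<close> times this
  particular sequence (\<open>frenet_system_unique\<close>). Here \<open>cos \<theta> \<noteq> 0\<close>, because otherwise \<open>X\<close> would be
  orthogonal to the whole frame and vanish; dividing by \<open>cos \<theta>\<close> yields the condition. In the other
  direction the condition provides a parallel field whose length is constant and at least \<open>1\<close>, since its
  coefficient at \<open>v\<^sub>1\<close> is \<open>1\<close>; its normalization is a unit parallel field whose product with \<open>v\<^sub>1\<close> is
  a constant in \<open>(0, 1]\<close>, hence a cosine.

  Two analytic points remain. The derivative of \<open>\<langle>X, Y\<rangle>\<close> is computed in a chart from the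
  characterization of the Christoffel symbols (\<open>has_real_derivative_inner_at\<close>). And the candidate axis must
  be smooth, which requires the smoothness of the speed, since arc length derivatives divide by it
  (\<open>smooth_speed\<close>).
\<close>

section \<open>Calculus of smooth maps\<close>

lemma Ck_on_Suc_has_derivative:
  assumes "Ck_on (Suc m) f S" "x \<in> S"
  shows "(f has_derivative frechet_derivative f (at x)) (at x)"
  using assms by (simp add: frechet_derivative_works)

lemma Ck_on_cong:
  assumes "open S" "\<And>x. x \<in> S \<Longrightarrow> f x = g x" "Ck_on m f S"
  shows "Ck_on m g S"
  using assms(2,3)
proof (induction m arbitrary: f g)
  case 0
  then show ?case by (simp cong: continuous_on_cong)
next
  case (Suc m)
  have D: "(g has_derivative frechet_derivative f (at x)) (at x)" if "x \<in> S" for x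
    by (rule has_derivative_transform_within_open[OF Ck_on_Suc_has_derivative[OF Suc.prems(2) that]
          \<open>open S\<close> that Suc.prems(1)])
  have eq: "frechet_derivative f (at x) = frechet_derivative g (at x)" if "x \<in> S" for x
    by (rule frechet_derivative_at[OF D[OF that]])
  have "Ck_on m (\<lambda>x. frechet_derivative g (at x) w) S" for w
  proof (rule Suc.IH)
    show "Ck_on m (\<lambda>x. frechet_derivative f (at x) w) S"
      using Suc.prems(2) by simp
  qed (simp add: eq)
  with D show ?case
    unfolding Ck_on.simps(2) differentiable_def by blast
qed

text \<open>
  Every closure property below is proved by induction on the order of differentiability. This rule
  replaces the \<open>frechet_derivative\<close> of the definition by any formula for the derivative on \<open>S\<close>.
\<close>

lemma Ck_on_SucI:
  assumes "open S" "\<And>x. x \<in> S \<Longrightarrow> (f has_derivative f' x) (at x)" "\<And>w. Ck_on m (\<lambda>x. f' x w) S"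
  shows "Ck_on (Suc m) f S"
proof -
  have "f' x = frechet_derivative f (at x)" if "x \<in> S" for x
    using frechet_derivative_at[OF assms(2)[OF that]] .
  then have "Ck_on m (\<lambda>x. frechet_derivative f (at x) w) S" for w
    using Ck_on_cong[OF assms(1) _ assms(3)[of w]] by simp
  with assms(2) show ?thesis
    by (auto simp: differentiable_def)
qed

lemma Ck_on_SucD: "Ck_on (Suc m) f S \<Longrightarrow> Ck_on m f S"
proof (induction m arbitrary: f)
  case 0
  then show ?case
    by (simp add: continuous_at_imp_continuous_on differentiable_imp_continuous_within)
next
  case (Suc m)
  show ?case
    unfolding Ck_on.simps(2)[of m]
  proof (intro conjI allI)
    show "\<forall>x\<in>S. f differentiable (at x)"
      using Suc.prems by simp
    show "Ck_on m (\<lambda>x. frechet_derivative f (at x) w) S" for w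
      using Suc.prems by (intro Suc.IH) (simp only: Ck_on.simps(2)[of "Suc m"])
  qed
qed

lemma Ck_on_subset: "Ck_on m f S \<Longrightarrow> T \<subseteq> S \<Longrightarrow> Ck_on m f T"
  by (induction m arbitrary: f) (auto intro: continuous_on_subset)

lemma Ck_on_local:
  assumes "\<And>x. x \<in> S \<Longrightarrow> \<exists>U. open U \<and> x \<in> U \<and> Ck_on m f U"
  shows "Ck_on m f S"
  using assms
proof (induction m arbitrary: f)
  case 0
  have "isCont f x" if "x \<in> S" for x
    using 0[OF that] by (auto simp: continuous_on_eq_continuous_at)
  then show ?case
    by (simp add: continuous_at_imp_continuous_on)
next
  case (Suc m)
  have "f differentiable (at x)" if "x \<in> S" for x
    using Suc.prems[OF that] by auto
  moreover have "Ck_on m (\<lambda>x. frechet_derivative f (at x) w) S" for w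
  proof (rule Suc.IH)
    fix x
    assume "x \<in> S"
    then obtain U where "open U" "x \<in> U" "Ck_on (Suc m) f U"
      using Suc.prems by blast
    then show "\<exists>U. open U \<and> x \<in> U \<and> Ck_on m (\<lambda>x. frechet_derivative f (at x) w) U"
      by (intro exI[of _ U]) simp
  qed
  ultimately show ?case
    by simp
qed

lemma Ck_on_const: "Ck_on m (\<lambda>x. c) S"
  by (induction m arbitrary: c) auto

lemma Ck_on_add:
  assumes "open S" "Ck_on m f S" "Ck_on m g S"
  shows "Ck_on m (\<lambda>x. f x + g x) S"
  using assms(2,3)
proof (induction m arbitrary: f g)
  case 0
  then show ?case by (simp add: continuous_on_add)
next
  case (Suc m)
  show ?case
  proof (rule Ck_on_SucI[OF \<open>open S\<close>])
    show "((\<lambda>x. f x + g x) has_derivative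
        (\<lambda>h. frechet_derivative f (at x) h + frechet_derivative g (at x) h)) (at x)" if "x \<in> S" for x
      using Suc.prems[THEN Ck_on_Suc_has_derivative, OF that] by (rule has_derivative_add)
    show "Ck_on m (\<lambda>x. frechet_derivative f (at x) w + frechet_derivative g (at x) w) S" for w
      using Suc.prems by (intro Suc.IH) simp_all
  qed
qed

lemma (in bounded_bilinear) Ck_on:
  assumes "open S" "Ck_on m f S" "Ck_on m g S"
  shows "Ck_on m (\<lambda>x. prod (f x) (g x)) S"
  using assms(2,3)
proof (induction m arbitrary: f g)
  case 0
  then show ?case by (simp add: continuous_on)
next
  case (Suc m)
  show ?case
  proof (rule Ck_on_SucI[OF \<open>open S\<close>])
    show "((\<lambda>x. prod (f x) (g x)) has_derivative (\<lambda>h. prod (f x) (frechet_derivative g (at x) h)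
        + prod (frechet_derivative f (at x) h) (g x))) (at x)" if "x \<in> S" for x
      using Suc.prems[THEN Ck_on_Suc_has_derivative, OF that] by (rule FDERIV)
    show "Ck_on m (\<lambda>x. prod (f x) (frechet_derivative g (at x) w)
        + prod (frechet_derivative f (at x) w) (g x)) S" for w
      using Suc.prems Suc.prems[THEN Ck_on_SucD]
      by (intro Ck_on_add[OF \<open>open S\<close>] Suc.IH) simp_all
  qed
qed

lemma (in bounded_linear) Ck_on:
  assumes "open S" "Ck_on m g S"
  shows "Ck_on m (\<lambda>x. f (g x)) S"
  using assms(2)
proof (induction m arbitrary: g)
  case 0
  then show ?case by (simp add: continuous_on)
next
  case (Suc m)
  show ?case
  proof (rule Ck_on_SucI[OF \<open>open S\<close>])
    show "((\<lambda>x. f (g x)) has_derivative (\<lambda>h. f (frechet_derivative g (at x) h))) (at x)"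
      if "x \<in> S" for x
      using Ck_on_Suc_has_derivative[OF Suc.prems that] by (rule has_derivative)
    show "Ck_on m (\<lambda>x. f (frechet_derivative g (at x) w)) S" for w
      using Suc.prems by (intro Suc.IH) simp
  qed
qed

lemma Ck_on_inverse:
  fixes f :: "'a::real_normed_vector \<Rightarrow> real"
  assumes "open S" "Ck_on m f S" "\<And>x. x \<in> S \<Longrightarrow> f x \<noteq> 0"
  shows "Ck_on m (\<lambda>x. inverse (f x)) S"
  using assms(2)
proof (induction m)
  case 0
  then show ?case using assms(3) by (simp add: continuous_on_inverse)
next
  case (Suc m)
  note mult = bounded_bilinear.Ck_on[OF bounded_bilinear_mult \<open>open S\<close>]
  have inv: "Ck_on m (\<lambda>x. inverse (f x)) S"
    by (rule Suc.IH[OF Ck_on_SucD[OF Suc.prems]])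
  have D: "((\<lambda>x. inverse (f x)) has_derivative
      (\<lambda>h. -1 * (inverse (f x) * frechet_derivative f (at x) h * inverse (f x)))) (at x)" if "x \<in> S" for x
    using Deriv.has_derivative_inverse[OF assms(3)[OF that] Ck_on_Suc_has_derivative[OF Suc.prems that]] by simp
  have "Ck_on m (\<lambda>x. -1 * (inverse (f x) * frechet_derivative f (at x) w * inverse (f x))) S" for w
    using Suc.prems by (intro mult inv Ck_on_const) simp
  with D show ?case
    by (rule Ck_on_SucI[OF \<open>open S\<close>])
qed

lemma smooth_on_cong:
  "open S \<Longrightarrow> smooth_on f S \<Longrightarrow> (\<And>x. x \<in> S \<Longrightarrow> f x = g x) \<Longrightarrow> smooth_on g S"
  unfolding smooth_on_def using Ck_on_cong[of S f g] by blast

lemma smooth_on_subset: "smooth_on f S \<Longrightarrow> T \<subseteq> S \<Longrightarrow> smooth_on f T"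
  unfolding smooth_on_def using Ck_on_subset by blast

lemma smooth_on_local:
  assumes "\<And>x. x \<in> S \<Longrightarrow> \<exists>U. open U \<and> x \<in> U \<and> smooth_on f U"
  shows "smooth_on f S"
  using assms unfolding smooth_on_def by (meson Ck_on_local)

lemma smooth_on_const: "smooth_on (\<lambda>x. c) S"
  by (simp add: smooth_on_def Ck_on_const)

lemma smooth_on_add:
  "open S \<Longrightarrow> smooth_on f S \<Longrightarrow> smooth_on g S \<Longrightarrow> smooth_on (\<lambda>x. f x + g x) S"
  by (simp add: smooth_on_def Ck_on_add)

lemma smooth_on_sum:
  "finite A \<Longrightarrow> open S \<Longrightarrow> (\<And>i. i \<in> A \<Longrightarrow> smooth_on (f i) S) \<Longrightarrow> smooth_on (\<lambda>x. \<Sum>i\<in>A. f i x) S"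
  by (induction A rule: finite_induct) (auto intro: smooth_on_const smooth_on_add)

lemma smooth_on_scaleR:
  "open S \<Longrightarrow> smooth_on f S \<Longrightarrow> smooth_on g S \<Longrightarrow> smooth_on (\<lambda>x. f x *\<^sub>R g x) S"
  by (simp add: smooth_on_def bounded_bilinear.Ck_on[OF bounded_bilinear_scaleR])

lemma smooth_on_mult:
  "open S \<Longrightarrow> smooth_on f S \<Longrightarrow> smooth_on g S \<Longrightarrow> smooth_on (\<lambda>x. f x * g x :: real) S"
  using smooth_on_scaleR[of S f g] by simp

lemma smooth_on_vec_nth: "open S \<Longrightarrow> smooth_on f S \<Longrightarrow> smooth_on (\<lambda>x. f x $ i) S"
  by (simp add: smooth_on_def bounded_linear.Ck_on[OF bounded_linear_vec_nth])

lemma smooth_on_divide: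
  fixes f g :: "'a::real_normed_vector \<Rightarrow> real"
  assumes "open S" "smooth_on f S" "smooth_on g S" "\<And>x. x \<in> S \<Longrightarrow> g x \<noteq> 0"
  shows "smooth_on (\<lambda>x. f x / g x) S"
proof -
  have "smooth_on (\<lambda>x. inverse (g x)) S"
    using assms by (simp add: smooth_on_def Ck_on_inverse)
  from smooth_on_mult[OF assms(1,2) this] show ?thesis
    by (simp add: divide_inverse)
qed

lemma smooth_on_imp_differentiable: "smooth_on f S \<Longrightarrow> x \<in> S \<Longrightarrow> f differentiable (at x)"
  unfolding smooth_on_def by (metis Ck_on.simps(2))

lemma smooth_on_vector_derivative:
  fixes f :: "real \<Rightarrow> 'b::real_normed_vector"
  assumes "open S" "smooth_on f S"
  shows "smooth_on (\<lambda>t. vector_derivative f (at t)) S"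
  unfolding smooth_on_def
proof
  fix m
  have "Ck_on (Suc m) f S"
    using assms(2) by (simp add: smooth_on_def del: Ck_on.simps)
  then have "Ck_on m (\<lambda>t. frechet_derivative f (at t) 1) S"
    by simp
  moreover have "frechet_derivative f (at t) 1 = vector_derivative f (at t)" if "t \<in> S" for t
  proof -
    have "(f has_derivative (\<lambda>h. h *\<^sub>R vector_derivative f (at t))) (at t)"
      using smooth_on_imp_differentiable[OF assms(2) that]
      by (simp only: vector_derivative_works has_vector_derivative_def)
    from frechet_derivative_at[OF this, symmetric] show ?thesis
      by simp
  qed
  ultimately show "Ck_on m (\<lambda>t. vector_derivative f (at t)) S"
    by (rule Ck_on_cong[OF assms(1), rotated])
qed

lemma smooth_on_deriv:
  fixes f :: "real \<Rightarrow> real"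
  assumes "open S" "smooth_on f S"
  shows "smooth_on (deriv f) S"
  using smooth_on_cong[OF assms(1) smooth_on_vector_derivative[OF assms]]
  by (simp add: field_derivative_eq_vector_derivative)

section \<open>Metric compatibility of the covariant derivative\<close>

text \<open>
  For use pointwise in one chart, where the arguments are covariant derivatives or members of the frame.
\<close>

lemma bounded_bilinear_inner_at: "bounded_bilinear (inner_at M \<phi> p)"
  unfolding inner_at_def[abs_def]
  by (rule bounded_bilinear.comp[OF bounded_bilinear_inner bounded_linear_ident
        matrix_vector_mul_bounded_linear])

lemmas inner_at_simps =
  bounded_bilinear.add_left[OF bounded_bilinear_inner_at]
  bounded_bilinear.add_right[OF bounded_bilinear_inner_at]
  bounded_bilinear.diff_left[OF bounded_bilinear_inner_at]
  bounded_bilinear.diff_right[OF bounded_bilinear_inner_at]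
  bounded_bilinear.scaleR_left[OF bounded_bilinear_inner_at]
  bounded_bilinear.scaleR_right[OF bounded_bilinear_inner_at]
  bounded_bilinear.sum_left[OF bounded_bilinear_inner_at]
  bounded_bilinear.sum_right[OF bounded_bilinear_inner_at]
  bounded_bilinear.zero_left[OF bounded_bilinear_inner_at]
  bounded_bilinear.zero_right[OF bounded_bilinear_inner_at]

text \<open>
  The Levi-Civita property of the Christoffel symbols speaks of partial derivatives of single entries,
  while the chain rule along a curve produces the derivative of the matrix; this formula connects them.
\<close>

lemma frechet_derivative_matrix_entry:
  fixes G :: "real ^ 'n::finite \<Rightarrow> real ^ 'n ^ 'n"
  assumes "G differentiable (at x)"
  shows "frechet_derivative G (at x) w $ i $ j = (\<Sum>k\<in>UNIV. w $ k * pd k (\<lambda>y. G y $ i $ j) x)"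
proof -
  define D where "D = frechet_derivative G (at x)"
  have D: "(G has_derivative D) (at x)"
    using assms by (simp add: D_def frechet_derivative_works)
  have "((\<lambda>y. G y $ i $ j) has_derivative (\<lambda>h. D h $ i $ j)) (at x)"
    by (intro bounded_linear.has_derivative[OF bounded_linear_vec_nth] D)
  from frechet_derivative_at[OF this, symmetric]
  have pd: "pd k (\<lambda>y. G y $ i $ j) x = D (axis k 1) $ i $ j" for k
    by (simp add: pd_def)
  have "linear D"
    using D by (rule has_derivative_linear)
  have "D w = D (\<Sum>k\<in>UNIV. w $ k *\<^sub>R axis k 1)"
    using basis_expansion[of w] by (simp add: scalar_mult_eq_scaleR)
  also have "\<dots> = (\<Sum>k\<in>UNIV. w $ k *\<^sub>R D (axis k 1))"
    using \<open>linear D\<close> by (simp add: linear_sum linear_cmul)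
  finally show ?thesis
    by (simp add: D_def[symmetric] pd)
qed

text \<open>
  The connection form of the chart, evaluated at the vector \<open>w\<close>: covariant differentiation in the
  direction \<open>w\<close> is the derivative of the components plus multiplication by this matrix.
\<close>

definition connection_matrix ::
  "(real ^ 'n \<Rightarrow> real ^ 'n ^ 'n) \<Rightarrow> real ^ 'n \<Rightarrow> real ^ 'n \<Rightarrow> real ^ 'n::finite ^ 'n" where
  "connection_matrix G x w = (\<chi> l m. \<Sum>i\<in>UNIV. christoffel G l i m x * w $ i)"

lemma cov_deriv_eq:
  "cov_deriv M \<alpha> X \<phi> t = vector_derivative (X \<phi>) (at t)
     + connection_matrix (gram M \<phi>) (coords \<phi> (\<alpha> t)) (velocity \<alpha> \<phi> t) *v X \<phi> t"
  unfolding cov_deriv_def connection_matrix_def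
  by (simp add: vec_eq_iff matrix_vector_mult_def sum_distrib_right)
    (intro allI, rule sum.swap)

text \<open>
  The metric is parallel. In matrix form the index sums collapse: the derivative of the Gram matrix \<open>G\<close> is
  \<open>A\<^sup>T G + G A\<close> for the connection matrix \<open>A\<close>, and both summands can be moved onto the arguments of
  the inner product.
\<close>

lemma frechet_derivative_metric:
  fixes G :: "real ^ 'n::finite \<Rightarrow> real ^ 'n ^ 'n"
  assumes "G differentiable (at x)" "open S" "x \<in> S"
    and sym: "\<And>y i j. y \<in> S \<Longrightarrow> G y $ i $ j = G y $ j $ i" and "invertible (G x)"
  shows "frechet_derivative G (at x) w
     = transpose (connection_matrix G x w) ** G x + G x ** connection_matrix G x w"
proof -
  have "pd k (\<lambda>y. G y $ i $ j) x = (\<Sum>l\<in>UNIV. christoffel G l k i x * G x $ l $ j)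
      + (\<Sum>l\<in>UNIV. christoffel G l k j x * G x $ i $ l)" for k i j
    using christoffel_levi_civita[of S G x "\<lambda>k i j. christoffel G k i j x"] assms by simp
  then have "frechet_derivative G (at x) w $ i $ j
      = (\<Sum>k\<in>UNIV. \<Sum>l\<in>UNIV. christoffel G l k i x * w $ k * G x $ l $ j)
      + (\<Sum>k\<in>UNIV. \<Sum>l\<in>UNIV. G x $ i $ l * (christoffel G l k j x * w $ k))" for i j
    unfolding frechet_derivative_matrix_entry[OF assms(1)]
    by (simp add: sum.distrib sum_distrib_left algebra_simps)
  also have "\<dots> i j
      = (\<Sum>l\<in>UNIV. \<Sum>k\<in>UNIV. christoffel G l k i x * w $ k * G x $ l $ j)
      + (\<Sum>l\<in>UNIV. \<Sum>k\<in>UNIV. G x $ i $ l * (christoffel G l k j x * w $ k))" for i j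
    by (intro arg_cong2[of _ _ _ _ "(+)"]; rule sum.swap)
  finally show ?thesis
    by (simp add: vec_eq_iff matrix_matrix_mult_def transpose_def connection_matrix_def
        sum_distrib_right sum_distrib_left)
qed

lemma gram_symmetric:
  assumes "riemannian_manifold M" "\<phi> \<in> atlas M" "x \<in> chart_image \<phi>"
  shows "gram M \<phi> x $ i $ j = gram M \<phi> x $ j $ i"
proof -
  obtain p where p: "p \<in> chart_dom \<phi>" "x = coords \<phi> p"
    using assms(3) by blast
  have "inner_at M \<phi> p (axis i 1) (axis j 1) = gram M \<phi> x $ i $ j" for i j
    by (simp add: inner_at_def p matrix_vector_mult_basis column_def inner_axis inner_commute[of "axis _ _"])
  moreover have "inner_at M \<phi> p (axis i 1) (axis j 1) = inner_at M \<phi> p (axis j 1) (axis i 1)"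
    using assms p(1) unfolding riemannian_manifold_def by blast
  ultimately show ?thesis
    by simp
qed

text \<open>
  A positive definite matrix has trivial kernel.
\<close>

lemma gram_invertible:
  assumes "riemannian_manifold M" "\<phi> \<in> atlas M" "x \<in> chart_image \<phi>"
  shows "invertible (gram M \<phi> x)"
proof -
  obtain p where p: "p \<in> chart_dom \<phi>" "x = coords \<phi> p"
    using assms(3) by blast
  have pos: "u \<noteq> 0 \<Longrightarrow> inner_at M \<phi> p u u > 0" for u
    using assms p(1) unfolding riemannian_manifold_def by blast
  have "u = 0" if "gram M \<phi> x *v u = 0" for u
    using pos[of u] that by (auto simp: inner_at_def p(2))
  then show ?thesis
    by (simp add: invertible_left_inverse matrix_left_invertible_ker)
qed

lemma bounded_bilinear_matrix_vector_mult:
  "bounded_bilinear (\<lambda>(A :: real ^ 'n ^ 'm::finite) (x :: real ^ 'n::finite). A *v x)"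
  unfolding bilinear_conv_bounded_bilinear[symmetric]
  by (simp add: bilinear_def linear_iff matrix_vector_mult_add_rdistrib matrix_vector_right_distrib
      scaleR_matrix_vector_assoc matrix_vector_mult_scaleR)

text \<open>
  The product rule for the metric. Differentiating \<open>X \<bullet> G Y\<close> along the curve, the term
  \<open>X \<bullet> (A\<^sup>T G + G A) Y\<close> completes the ordinary derivatives of \<open>X\<close> and \<open>Y\<close> to covariant ones.
\<close>

lemma has_real_derivative_inner_at:
  assumes M: "riemannian_manifold M" "\<phi> \<in> atlas M" "\<alpha> t \<in> chart_dom \<phi>"
    and \<alpha>: "(\<lambda>s. coords \<phi> (\<alpha> s)) differentiable (at t)"
    and X: "X \<phi> differentiable (at t)" and Y: "Y \<phi> differentiable (at t)"
  shows "((\<lambda>s. inner_at M \<phi> (\<alpha> s) (X \<phi> s) (Y \<phi> s)) has_real_derivative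
      inner_at M \<phi> (\<alpha> t) (cov_deriv M \<alpha> X \<phi> t) (Y \<phi> t)
    + inner_at M \<phi> (\<alpha> t) (X \<phi> t) (cov_deriv M \<alpha> Y \<phi> t)) (at t)"
proof -
  define x where "x = (\<lambda>s. coords \<phi> (\<alpha> s))"
  define w where "w = velocity \<alpha> \<phi> t"
  define G where "G = gram M \<phi>"
  define A where "A = connection_matrix G (x t) w"
  define X' Y' where "X' = vector_derivative (X \<phi>) (at t)" and "Y' = vector_derivative (Y \<phi>) (at t)"
  have xt: "x t \<in> chart_image \<phi>"
    using M(3) by (simp add: x_def)
  have "open (chart_image \<phi>)" "smooth_on G (chart_image \<phi>)"
    using M(1,2) by (auto simp: riemannian_manifold_def smooth_manifold_def is_chart_def G_def)
  then have G: "G differentiable (at (x t))"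
    using smooth_on_imp_differentiable xt by blast
  have x': "(x has_vector_derivative w) (at t)"
    using \<alpha> vector_derivative_works unfolding x_def w_def velocity_def by blast
  have "((\<lambda>s. G (x s)) has_vector_derivative frechet_derivative G (at (x t)) w) (at t)"
    using vector_derivative_diff_chain_within[OF x', of G] G
    by (simp add: frechet_derivative_works has_derivative_at_withinI o_def)
  then have G': "((\<lambda>s. G (x s)) has_vector_derivative (transpose A ** G (x t) + G (x t) ** A)) (at t)"
    using frechet_derivative_metric[OF G \<open>open (chart_image \<phi>)\<close> xt]
      gram_symmetric[OF M(1,2)] gram_invertible[OF M(1,2) xt]
    by (simp add: A_def G_def)
  have X': "(X \<phi> has_vector_derivative X') (at t)" and Y': "(Y \<phi> has_vector_derivative Y') (at t)"
    using X Y by (simp_all add: vector_derivative_works X'_def Y'_def)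
  have "((\<lambda>s. X \<phi> s \<bullet> (G (x s) *v Y \<phi> s)) has_vector_derivative
      X \<phi> t \<bullet> (G (x t) *v Y' + (transpose A ** G (x t) + G (x t) ** A) *v Y \<phi> t)
      + X' \<bullet> (G (x t) *v Y \<phi> t)) (at t)"
    by (intro bounded_bilinear.has_vector_derivative[OF bounded_bilinear_inner]
        bounded_bilinear.has_vector_derivative[OF bounded_bilinear_matrix_vector_mult] X' Y' G')
  also have "X \<phi> t \<bullet> (G (x t) *v Y' + (transpose A ** G (x t) + G (x t) ** A) *v Y \<phi> t)
      + X' \<bullet> (G (x t) *v Y \<phi> t)
      = (X' + A *v X \<phi> t) \<bullet> (G (x t) *v Y \<phi> t) + X \<phi> t \<bullet> (G (x t) *v (Y' + A *v Y \<phi> t))"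
    by (simp add: matrix_vector_mult_add_rdistrib matrix_vector_right_distrib inner_add_left inner_add_right
        matrix_vector_mul_assoc[symmetric] dot_lmul_matrix[symmetric] vector_matrix_left_distrib
        del: transpose_matrix_vector)
  finally show ?thesis
    by (simp add: has_real_derivative_iff_has_vector_derivative inner_at_def cov_deriv_eq
        x_def w_def G_def A_def X'_def Y'_def)
qed

section \<open>Linear algebra of tangent vectors\<close>

lemma linear_change_comps:
  assumes "smooth_manifold M" "\<phi> \<in> atlas M" "\<psi> \<in> atlas M" "p \<in> chart_dom \<phi> \<inter> chart_dom \<psi>"
  shows "linear (change_comps \<phi> \<psi> p)"
proof -
  have "smooth_on (transition \<phi> \<psi>) (coords \<phi> ` (chart_dom \<phi> \<inter> chart_dom \<psi>))"
    using assms(1-3) by (auto simp: smooth_manifold_def)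
  then have "transition \<phi> \<psi> differentiable (at (coords \<phi> p))"
    using assms(4) by (intro smooth_on_imp_differentiable) auto
  then show ?thesis
    unfolding change_comps_def by (rule linear_frechet_derivative)
qed

text \<open>
  Orthonormal vectors are independent, so as many of them as the dimension span the space; a vector
  orthogonal to all of them is then orthogonal to itself.
\<close>

lemma orthonormal_frame_complete:
  fixes e :: "nat \<Rightarrow> real ^ 'n::finite"
  assumes orth: "\<And>i j. i \<in> {1..CARD('n)} \<Longrightarrow> j \<in> {1..CARD('n)}
      \<Longrightarrow> inner_at M \<phi> p (e i) (e j) = (if i = j then 1 else 0)"
    and u: "\<And>i. i \<in> {1..CARD('n)} \<Longrightarrow> inner_at M \<phi> p (e i) u = 0"
  shows "inner_at M \<phi> p u u = 0"
proof -
  define A where "A = {1..CARD('n)}"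
  have inj: "inj_on e A"
  proof
    fix i j assume "i \<in> A" "j \<in> A" "e i = e j"
    then show "i = j"
      using orth[of i j] orth[of j j] by (auto simp: A_def split: if_splits)
  qed
  have "independent (e ` A)"
  proof (rule independent_if_scalars_zero)
    fix f x assume 0: "(\<Sum>x\<in>e ` A. f x *\<^sub>R x) = 0" and "x \<in> e ` A"
    then obtain j where j: "j \<in> A" "x = e j" by blast
    have "0 = inner_at M \<phi> p (\<Sum>i\<in>A. f (e i) *\<^sub>R e i) (e j)"
      using 0 by (simp add: sum.reindex[OF inj] inner_at_simps)
    also have "\<dots> = (\<Sum>i\<in>A. f (e i) * (if i = j then 1 else 0))"
      unfolding inner_at_simps using orth j(1) by (intro sum.cong) (auto simp: A_def)
    also have "\<dots> = f x"
      using j by (simp add: A_def if_distrib[of "(*) _"] cong: if_cong)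
    finally show "f x = 0" by simp
  qed (simp add: A_def)
  moreover have "card (e ` A) = CARD('n)"
    by (simp add: card_image[OF inj]) (simp add: A_def)
  ultimately have "UNIV \<subseteq> span (e ` A)"
    by (intro card_ge_dim_independent) auto
  moreover have "inner_at M \<phi> p x u = 0" if "x \<in> span (e ` A)" for x
    using that
  proof (induction rule: span_induct)
    case base
    then show ?case by (auto simp: subspace_def inner_at_simps)
  next
    case (step x)
    then show ?case using u by (auto simp: A_def)
  qed
  ultimately show ?thesis by blast
qed

section \<open>Frenet curves\<close>

locale frenet_curve =
  fixes M :: "('a, 'n::finite) riemannian" and I :: "real set" and \<alpha> :: "real \<Rightarrow> 'a"
    and v :: "nat \<Rightarrow> ('a, 'n) field_along" and k :: "nat \<Rightarrow> real \<Rightarrow> real" and n :: nat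
  assumes riemannian: "riemannian_manifold M"
    and n_eq: "n = CARD('n)" and dim: "n \<ge> 3"
    and open_I: "open I" and interval_I: "is_interval I"
    and regular: "regular_curve M I \<alpha> v k"
begin

abbreviation field :: "('a, 'n) field_along \<Rightarrow> bool" where "field \<equiv> vector_field_along M I \<alpha>"
abbreviation inner_prod :: "('a, 'n) field_along \<Rightarrow> ('a, 'n) field_along \<Rightarrow> real \<Rightarrow> real"
  where "inner_prod \<equiv> inner_along M \<alpha>"
abbreviation nabla :: "('a, 'n) field_along \<Rightarrow> ('a, 'n) field_along"
  where "nabla \<equiv> nabla_tangent M \<alpha>"
abbreviation D :: "(real \<Rightarrow> real) \<Rightarrow> real \<Rightarrow> real" where "D \<equiv> arc_deriv M \<alpha>"
abbreviation H :: "nat \<Rightarrow> real \<Rightarrow> real" where "H \<equiv> harmonic_curvature M \<alpha> k"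

text \<open>
  The curvatures, extended by zero to the indices \<open>0\<close> and \<open>n\<close>. This makes the Frenet equations uniform in
  \<open>i = 1, \<dots>, n\<close>: the values of the frame at \<open>0\<close> and \<open>n + 1\<close>, which are arbitrary, occur only with
  the factor \<open>0\<close>.
\<close>

definition K :: "nat \<Rightarrow> real \<Rightarrow> real" where
  "K i t = (if 1 \<le> i \<and> i < n then k i t else 0)"

lemma K_simps: "K 0 t = 0" "K n t = 0" "K (n - 1) t = k (n - 1) t"
  using dim by (auto simp: K_def)

lemma manifold: "smooth_manifold M"
  using riemannian by (simp add: riemannian_manifold_def)

lemma smooth_curve: "smooth_curve M I \<alpha>"
  and field_v: "i \<in> {1..n} \<Longrightarrow> field (v i)"
  and orthonormal: "i \<in> {1..n} \<Longrightarrow> j \<in> {1..n} \<Longrightarrow> t \<in> I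
    \<Longrightarrow> inner_prod (v i) (v j) t = (if i = j then 1 else 0)"
  and smooth_k: "i \<in> {1..n-1} \<Longrightarrow> smooth_on (k i) I"
  and k_nonzero: "i \<in> {1..n-1} \<Longrightarrow> t \<in> I \<Longrightarrow> k i t \<noteq> 0"
  using regular by (simp_all add: regular_curve_def n_eq[symmetric] Let_def)

lemma tangent:
  "\<phi> \<in> atlas M \<Longrightarrow> t \<in> I \<Longrightarrow> \<alpha> t \<in> chart_dom \<phi> \<Longrightarrow> v 1 \<phi> t = unit_tangent M \<alpha> \<phi> t"
  using regular by (simp add: regular_curve_def n_eq[symmetric] Let_def field_eq_def)

lemma frenet:
  assumes "i \<in> {1..n}" "\<phi> \<in> atlas M" "t \<in> I" "\<alpha> t \<in> chart_dom \<phi>"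
  shows "nabla (v i) \<phi> t = K i t *\<^sub>R v (i + 1) \<phi> t - K (i - 1) t *\<^sub>R v (i - 1) \<phi> t"
proof -
  consider "i = 1" | "1 < i" "i < n" | "i = n"
    using assms(1) by fastforce
  then show ?thesis
  proof cases
    case 1
    then show ?thesis
      using regular assms(2-) dim
      by (simp add: regular_curve_def n_eq[symmetric] Let_def field_eq_def K_def numeral_2_eq_2)
  next
    case 2
    then have "field_eq M I \<alpha> (nabla (v i)) (\<lambda>\<phi> t. - k (i-1) t *\<^sub>R v (i-1) \<phi> t + k i t *\<^sub>R v (i+1) \<phi> t)"
      using regular by (simp add: regular_curve_def n_eq[symmetric] Let_def)
    moreover have "1 \<le> i - 1" "i - 1 < n"
      using 2 by simp_all
    ultimately show ?thesis
      using 2 assms(2-) by (simp add: field_eq_def K_def)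
  next
    case 3
    then show ?thesis
      using regular assms(2-) dim by (simp add: regular_curve_def n_eq[symmetric] Let_def field_eq_def K_def)
  qed
qed

lemma open_chart_times:
  assumes "\<phi> \<in> atlas M"
  shows "open {t \<in> I. \<alpha> t \<in> chart_dom \<phi>}"
proof -
  have "openin (topo M) (chart_dom \<phi>)"
    using manifold assms by (auto simp: smooth_manifold_def is_chart_def)
  then have "openin (top_of_set I) {t \<in> topspace (top_of_set I). \<alpha> t \<in> chart_dom \<phi>}"
    using smooth_curve by (intro openin_continuous_map_preimage) (auto simp: smooth_curve_def)
  then show ?thesis
    using open_I by (simp add: openin_open_eq)
qed

text \<open>
  The chart that the definition of the inner product chooses at \<open>t\<close> depends only on \<open>t\<close>. There the
  product formula holds for arbitrary families of components, in particular for the covariant derivatives and for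
  the members of \<open>v\<close> with indices outside \<open>1, \<dots>, n\<close>.
\<close>

lemma selected_chart:
  assumes "t \<in> I"
  obtains \<phi> where "\<phi> \<in> atlas M" "\<alpha> t \<in> chart_dom \<phi>"
    "\<And>X Y. inner_prod X Y t = inner_at M \<phi> (\<alpha> t) (X \<phi> t) (Y \<phi> t)"
proof -
  have "\<alpha> t \<in> topspace (topo M)"
    using smooth_curve assms by (auto simp: smooth_curve_def continuous_map_def)
  also have "topspace (topo M) = (\<Union>\<phi>\<in>atlas M. chart_dom \<phi>)"
    using manifold by (simp add: smooth_manifold_def)
  finally have "\<exists>\<phi>. \<phi> \<in> atlas M \<and> \<alpha> t \<in> chart_dom \<phi>"
    by blast
  from someI_ex[OF this] show ?thesis
    by (intro that[of "SOME \<phi>. \<phi> \<in> atlas M \<and> \<alpha> t \<in> chart_dom \<phi>"]) (auto simp: inner_along_def Let_def)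
qed

lemma field_smooth: "field X \<Longrightarrow> \<phi> \<in> atlas M \<Longrightarrow> smooth_on (X \<phi>) {t \<in> I. \<alpha> t \<in> chart_dom \<phi>}"
  by (simp add: vector_field_along_def)

lemma coords_smooth: "\<phi> \<in> atlas M \<Longrightarrow> smooth_on (\<lambda>t. coords \<phi> (\<alpha> t)) {t \<in> I. \<alpha> t \<in> chart_dom \<phi>}"
  using smooth_curve by (simp add: smooth_curve_def)

lemma speed_nonzero:
  assumes "t \<in> I"
  shows "speed M \<alpha> t \<noteq> 0"
proof
  assume 0: "speed M \<alpha> t = 0"
  obtain \<phi> where \<phi>: "\<phi> \<in> atlas M" "\<alpha> t \<in> chart_dom \<phi>"
    "\<And>X Y. inner_prod X Y t = inner_at M \<phi> (\<alpha> t) (X \<phi> t) (Y \<phi> t)"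
    using selected_chart[OF assms] by blast
  have "inner_prod (v 1) (v 1) t = 0"
    using \<phi> tangent[OF \<phi>(1) assms \<phi>(2)] 0 by (simp add: unit_tangent_def inner_at_simps)
  then show False
    using orthonormal[of 1 1 t] assms dim by simp
qed

text \<open>
  In a chart the velocity is the speed times \<open>v 1\<close>. Since \<open>v 1\<close> does not vanish, the speed is locally a
  quotient of components of these two fields.
\<close>

lemma smooth_speed: "smooth_on (speed M \<alpha>) I"
proof (rule smooth_on_local)
  fix s assume "s \<in> I"
  obtain \<phi> where \<phi>: "\<phi> \<in> atlas M" "\<alpha> s \<in> chart_dom \<phi>"
      "\<And>X Y. inner_prod X Y s = inner_at M \<phi> (\<alpha> s) (X \<phi> s) (Y \<phi> s)"
    using selected_chart[OF \<open>s \<in> I\<close>] by blast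
  define T where "T = {t \<in> I. \<alpha> t \<in> chart_dom \<phi>}"
  have "open T" "s \<in> T"
    using open_chart_times[OF \<phi>(1)] \<open>s \<in> I\<close> \<phi>(2) by (auto simp: T_def)
  have "v 1 \<phi> s \<noteq> 0"
    using \<phi>(3) orthonormal[of 1 1 s] \<open>s \<in> I\<close> dim by (auto simp: inner_at_simps)
  then obtain i where i: "v 1 \<phi> s $ i \<noteq> 0"
    by (auto simp: vec_eq_iff)
  have v: "smooth_on (\<lambda>t. v 1 \<phi> t $ i) T"
    using field_smooth[OF field_v \<phi>(1), of 1] \<open>open T\<close> dim by (simp add: smooth_on_vec_nth T_def)
  have vel: "smooth_on (\<lambda>t. velocity \<alpha> \<phi> t $ i) T"
    unfolding velocity_def using coords_smooth[OF \<phi>(1)] \<open>open T\<close>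
    by (intro smooth_on_vec_nth smooth_on_vector_derivative) (simp_all add: T_def)
  define U where "U = {t \<in> T. v 1 \<phi> t $ i \<noteq> 0}"
  have "continuous_on T (\<lambda>t. v 1 \<phi> t $ i)"
    using v unfolding smooth_on_def by (metis Ck_on.simps(1))
  then have "open (T \<inter> (\<lambda>t. v 1 \<phi> t $ i) -` (- {0}))"
    using \<open>open T\<close> by (intro continuous_open_preimage) auto
  also have "T \<inter> (\<lambda>t. v 1 \<phi> t $ i) -` (- {0}) = U"
    by (auto simp: U_def)
  finally have "open U" .
  have "smooth_on (\<lambda>t. velocity \<alpha> \<phi> t $ i / v 1 \<phi> t $ i) U"
    using v vel \<open>open U\<close> by (intro smooth_on_divide) (auto simp: U_def intro: smooth_on_subset)
  moreover have "velocity \<alpha> \<phi> t $ i / v 1 \<phi> t $ i = speed M \<alpha> t" if "t \<in> U" for t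
    using that tangent[OF \<phi>(1), of t] speed_nonzero[of t]
    by (auto simp: U_def T_def unit_tangent_def field_simps)
  ultimately have "smooth_on (speed M \<alpha>) U"
    by (rule smooth_on_cong[OF \<open>open U\<close>])
  then show "\<exists>U. open U \<and> s \<in> U \<and> smooth_on (speed M \<alpha>) U"
    using \<open>open U\<close> \<open>s \<in> T\<close> i by (auto simp: U_def)
qed

lemma smooth_arc_deriv: "smooth_on f I \<Longrightarrow> smooth_on (D f) I"
  unfolding arc_deriv_def[abs_def]
  by (intro smooth_on_divide smooth_on_deriv smooth_speed open_I speed_nonzero)

text \<open>
  The product rule in a chart \<open>\<phi>\<close> around the point carries over to the inner product of the fields, which agrees
  with its expression in \<open>\<phi>\<close> near \<open>t\<close> although the chart chosen by its definition may vary with \<open>t\<close>.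
\<close>

lemma inner_prod_derivative:
  assumes X: "field X" and Y: "field Y" and t: "t \<in> I"
  shows "(inner_prod X Y has_real_derivative
    speed M \<alpha> t * (inner_prod (nabla X) Y t + inner_prod X (nabla Y) t)) (at t)"
proof -
  obtain \<phi> where \<phi>: "\<phi> \<in> atlas M" "\<alpha> t \<in> chart_dom \<phi>"
    "\<And>X Y. inner_prod X Y t = inner_at M \<phi> (\<alpha> t) (X \<phi> t) (Y \<phi> t)"
    using selected_chart[OF t] by blast
  define T where "T = {t \<in> I. \<alpha> t \<in> chart_dom \<phi>}"
  have T: "open T" "t \<in> T"
    using open_chart_times[OF \<phi>(1)] t \<phi>(2) by (auto simp: T_def)
  note diff = smooth_on_imp_differentiable[OF _ T(2)[unfolded T_def]]
  have "((\<lambda>s. inner_at M \<phi> (\<alpha> s) (X \<phi> s) (Y \<phi> s)) has_real_derivative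
      inner_at M \<phi> (\<alpha> t) (cov_deriv M \<alpha> X \<phi> t) (Y \<phi> t)
    + inner_at M \<phi> (\<alpha> t) (X \<phi> t) (cov_deriv M \<alpha> Y \<phi> t)) (at t)"
    by (intro has_real_derivative_inner_at riemannian \<phi> diff coords_smooth field_smooth X Y)
  then have "(inner_prod X Y has_real_derivative
      inner_at M \<phi> (\<alpha> t) (cov_deriv M \<alpha> X \<phi> t) (Y \<phi> t)
    + inner_at M \<phi> (\<alpha> t) (X \<phi> t) (cov_deriv M \<alpha> Y \<phi> t)) (at t)"
    by (rule has_field_derivative_transform_within_open[OF _ T])
      (use inner_along_eq[OF riemannian X Y \<phi>(1)] in \<open>auto simp: T_def\<close>)
  moreover have "cov_deriv M \<alpha> Z \<phi> t = speed M \<alpha> t *\<^sub>R nabla Z \<phi> t" for Z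
    using speed_nonzero[OF t] by (simp add: nabla_tangent_def)
  ultimately show ?thesis
    by (simp add: \<phi>(3) inner_at_simps distrib_left)
qed

lemma arc_deriv_inner_prod:
  "field X \<Longrightarrow> field Y \<Longrightarrow> t \<in> I
    \<Longrightarrow> D (inner_prod X Y) t = inner_prod (nabla X) Y t + inner_prod X (nabla Y) t"
  using DERIV_imp_deriv[OF inner_prod_derivative] speed_nonzero by (simp add: arc_deriv_def)

lemma inner_prod_parallel:
  assumes "LC_parallel M I \<alpha> X" "t \<in> I"
  shows "inner_prod (nabla X) Y t = 0" "inner_prod Y (nabla X) t = 0"
proof -
  obtain \<phi> where \<phi>: "\<phi> \<in> atlas M" "\<alpha> t \<in> chart_dom \<phi>"
    "\<And>X Y. inner_prod X Y t = inner_at M \<phi> (\<alpha> t) (X \<phi> t) (Y \<phi> t)"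
    using selected_chart[OF assms(2)] by blast
  have "nabla X \<phi> t = 0"
    using assms \<phi>(1,2) by (simp add: LC_parallel_def field_eq_def)
  then show "inner_prod (nabla X) Y t = 0" "inner_prod Y (nabla X) t = 0"
    by (simp_all add: \<phi>(3) inner_at_simps)
qed

lemma inner_prod_parallel_const:
  assumes "field X" "LC_parallel M I \<alpha> X"
  shows "\<exists>c. \<forall>t\<in>I. inner_prod X X t = c"
proof -
  have "(inner_prod X X has_real_derivative 0) (at t within I)" if "t \<in> I" for t
    using inner_prod_derivative[OF assms(1,1) that] inner_prod_parallel[OF assms(2) that]
    by (simp add: has_field_derivative_at_within)
  then show ?thesis
    using interval_I is_interval_convex by (intro has_field_derivative_zero_constant) auto
qed

definition combination :: "(nat \<Rightarrow> real \<Rightarrow> real) \<Rightarrow> ('a, 'n) field_along" where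
  "combination a \<phi> t = (\<Sum>i\<in>{1..n}. a i t *\<^sub>R v i \<phi> t)"

text \<open>
  The transformation law between charts passes to the combination because differentials are linear.
\<close>

lemma field_combination:
  assumes "\<And>i. i \<in> {1..n} \<Longrightarrow> smooth_on (a i) I"
  shows "field (combination a)"
  unfolding vector_field_along_def
proof (intro conjI ballI impI)
  fix \<phi> assume \<phi>: "\<phi> \<in> atlas M"
  show "smooth_on (combination a \<phi>) {t \<in> I. \<alpha> t \<in> chart_dom \<phi>}"
    unfolding combination_def[abs_def] using \<phi>
    by (intro smooth_on_sum smooth_on_scaleR open_chart_times field_smooth field_v
          smooth_on_subset[OF assms]) auto
next
  fix \<phi> \<psi> t assume \<phi>: "\<phi> \<in> atlas M" "\<psi> \<in> atlas M" "t \<in> I" "\<alpha> t \<in> chart_dom \<phi> \<inter> chart_dom \<psi>"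
  have "v i \<psi> t = change_comps \<phi> \<psi> (\<alpha> t) (v i \<phi> t)" if "i \<in> {1..n}" for i
    using field_v[OF that] \<phi> unfolding vector_field_along_def by blast
  then show "combination a \<psi> t = change_comps \<phi> \<psi> (\<alpha> t) (combination a \<phi> t)"
    using linear_change_comps[OF manifold \<phi>(1,2,4)]
    by (simp add: combination_def linear_sum linear_cmul)
qed

lemma inner_prod_combination_right: "inner_prod X (combination a) t = (\<Sum>i\<in>{1..n}. a i t * inner_prod X (v i) t)"
  by (simp add: combination_def inner_along_def Let_def inner_at_simps)

lemma inner_prod_combination_left: "inner_prod (combination a) X t = (\<Sum>i\<in>{1..n}. a i t * inner_prod (v i) X t)"
  by (simp add: combination_def inner_along_def Let_def inner_at_simps)

lemma inner_prod_v_combination: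
  assumes "j \<in> {1..n}" "t \<in> I"
  shows "inner_prod (v j) (combination a) t = a j t"
proof -
  have "inner_prod (v j) (combination a) t = (\<Sum>i\<in>{1..n}. if i = j then a i t else 0)"
    unfolding inner_prod_combination_right using assms orthonormal by (intro sum.cong) auto
  with assms(1) show ?thesis by simp
qed

lemma inner_prod_combination:
  "t \<in> I \<Longrightarrow> inner_prod (combination a) (combination a) t = (\<Sum>i\<in>{1..n}. (a i t)\<^sup>2)"
  unfolding inner_prod_combination_left by (simp add: inner_prod_v_combination power2_eq_square)

text \<open>
  The condition on coefficients with respect to the frame that characterizes parallel fields.
\<close>

definition frenet_system :: "(nat \<Rightarrow> real \<Rightarrow> real) \<Rightarrow> bool" where
  "frenet_system a \<longleftrightarrow>
     (\<forall>i\<in>{1..n}. \<forall>t\<in>I. D (a i) t = K i t * a (i + 1) t - K (i - 1) t * a (i - 1) t)"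

lemma nabla_combination:
  assumes a: "\<And>i. i \<in> {1..n} \<Longrightarrow> smooth_on (a i) I"
    and \<phi>: "\<phi> \<in> atlas M" "t \<in> I" "\<alpha> t \<in> chart_dom \<phi>"
  shows "nabla (combination a) \<phi> t = (\<Sum>i\<in>{1..n}. D (a i) t *\<^sub>R v i \<phi> t + a i t *\<^sub>R nabla (v i) \<phi> t)"
proof -
  define A where "A = connection_matrix (gram M \<phi>) (coords \<phi> (\<alpha> t)) (velocity \<alpha> \<phi> t)"
  have "(a i has_real_derivative deriv (a i) t) (at t)" if "i \<in> {1..n}" for i
    using smooth_on_imp_differentiable[OF a[OF that] \<phi>(2)] real_differentiable_def DERIV_imp_deriv by metis
  moreover have "(v i \<phi> has_vector_derivative vector_derivative (v i \<phi>) (at t)) (at t)" if "i \<in> {1..n}" for i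
    using smooth_on_imp_differentiable[OF field_smooth[OF field_v[OF that] \<phi>(1)]] \<phi>
    by (simp add: vector_derivative_works[symmetric])
  ultimately have "(combination a \<phi> has_vector_derivative
      (\<Sum>i\<in>{1..n}. a i t *\<^sub>R vector_derivative (v i \<phi>) (at t) + deriv (a i) t *\<^sub>R v i \<phi> t)) (at t)"
    unfolding combination_def[abs_def]
    by (intro has_vector_derivative_sum has_vector_derivative_scaleR)
  then have "cov_deriv M \<alpha> (combination a) \<phi> t
      = (\<Sum>i\<in>{1..n}. a i t *\<^sub>R vector_derivative (v i \<phi>) (at t) + deriv (a i) t *\<^sub>R v i \<phi> t)
        + A *v combination a \<phi> t"
    unfolding cov_deriv_eq A_def by (simp add: vector_derivative_at)
  also have "\<dots> = (\<Sum>i\<in>{1..n}. deriv (a i) t *\<^sub>R v i \<phi> t + a i t *\<^sub>R cov_deriv M \<alpha> (v i) \<phi> t)"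
    unfolding cov_deriv_eq A_def[symmetric]
    by (simp add: combination_def linear_sum[OF matrix_vector_mul_linear] matrix_vector_mult_scaleR
        scaleR_add_right sum.distrib)
  finally show ?thesis
    by (simp add: nabla_tangent_def arc_deriv_def scaleR_sum_right scaleR_add_right divide_inverse
        mult.commute sum.distrib)
qed

text \<open>
  By the Frenet equations and the system, the \<open>i\<close>-th summand of the covariant derivative is
  \<open>h\<^sub>i - h\<^bsub>i-1\<^esub>\<close> with \<open>h\<^sub>i = K\<^sub>i (a\<^bsub>i+1\<^esub> v\<^sub>i + a\<^sub>i v\<^bsub>i+1\<^esub>)\<close>. The sum telescopes, and its
  two boundary terms vanish with \<open>K\<^sub>0\<close> and \<open>K\<^sub>n\<close>.
\<close>

lemma LC_parallel_combination:
  assumes a: "\<And>i. i \<in> {1..n} \<Longrightarrow> smooth_on (a i) I" and sys: "frenet_system a"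
  shows "LC_parallel M I \<alpha> (combination a)"
  unfolding LC_parallel_def field_eq_def
proof (intro ballI impI)
  fix \<phi> t assume \<phi>: "\<phi> \<in> atlas M" "t \<in> I" "\<alpha> t \<in> chart_dom \<phi>"
  define h where "h i = (K i t * a (i + 1) t) *\<^sub>R v i \<phi> t + (K i t * a i t) *\<^sub>R v (i + 1) \<phi> t" for i
  have step: "D (a i) t *\<^sub>R v i \<phi> t + a i t *\<^sub>R nabla (v i) \<phi> t = h i - h (i - 1)" if "i \<in> {1..n}" for i
  proof -
    have "D (a i) t = K i t * a (i + 1) t - K (i - 1) t * a (i - 1) t"
      using sys that \<phi>(2) by (simp add: frenet_system_def)
    moreover have "i - 1 + 1 = i"
      using that by simp
    ultimately show ?thesis
      unfolding frenet[OF that \<phi>] h_def by (simp only:) (simp add: algebra_simps)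
  qed
  have "nabla (combination a) \<phi> t
      = (\<Sum>i\<in>{1..n}. D (a i) t *\<^sub>R v i \<phi> t + a i t *\<^sub>R nabla (v i) \<phi> t)"
    using a \<phi> by (rule nabla_combination)
  also have "\<dots> = (\<Sum>i\<in>{1..n}. h i - h (i - 1))"
    by (rule sum.cong[OF refl step])
  also have "\<dots> = h n - h 0"
    using sum_telescope''[of 0 n h] by (simp add: atLeastSucAtMost_greaterThanAtMost)
  also have "\<dots> = 0"
    by (simp add: h_def K_def)
  finally show "nabla (combination a) \<phi> t = 0" .
qed

section \<open>Harmonic curvatures as coefficients of the axis\<close>

text \<open>
  The coefficients \<open>1, 0, H\<^sub>1, \<dots>, H\<^bsub>n-2\<^esub>\<close> of the axis, up to a factor. The truncated
  subtraction gives \<open>H\<^sub>0 = 0\<close> at the index \<open>2\<close>, as it should be, and also at the index \<open>0\<close>.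
\<close>

definition axis_coeff :: "nat \<Rightarrow> real \<Rightarrow> real" where
  "axis_coeff i = (if i = 1 then (\<lambda>t. 1) else H (i - 2))"

text \<open>
  The bound on \<open>i\<close> ensures that only the nonvanishing curvatures \<open>k 2, \<dots>, k (n - 1)\<close> are divided by.
\<close>

lemma smooth_H: "i \<le> n - 2 \<Longrightarrow> smooth_on (H i) I"
proof (induction i rule: induct_nat_012)
  case 0
  then show ?case by (simp add: smooth_on_const)
next
  case 1
  show ?case
    unfolding harmonic_curvature.simps using dim
    by (intro smooth_on_divide smooth_k k_nonzero open_I) auto
next
  case (ge2 i)
  then show ?case
    unfolding harmonic_curvature.simps
    by (intro smooth_on_mult smooth_on_add smooth_on_divide smooth_on_const smooth_arc_deriv
        smooth_k k_nonzero open_I) auto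
qed

lemma smooth_axis_coeff: "i \<in> {1..n} \<Longrightarrow> smooth_on (axis_coeff i) I"
  by (auto simp: axis_coeff_def smooth_on_const intro!: smooth_H)

lemma arc_deriv_cong:
  assumes "\<And>s. s \<in> I \<Longrightarrow> f s = g s" "t \<in> I"
  shows "D f t = D g t"
proof -
  have "eventually (\<lambda>s. f s = g s) (nhds t)"
    using assms open_I by (auto simp: eventually_nhds)
  then show ?thesis
    by (simp add: arc_deriv_def deriv_cong_ev)
qed

lemma arc_deriv_const: "D (\<lambda>t. c) t = 0"
  by (simp add: arc_deriv_def)

lemma arc_deriv_cmult: "smooth_on f I \<Longrightarrow> t \<in> I \<Longrightarrow> D (\<lambda>t. c * f t) t = c * D f t"
  using smooth_on_imp_differentiable[of f I t]
  by (simp add: arc_deriv_def deriv_cmult field_differentiable_def real_differentiable_def)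

text \<open>
  All equations of the system but the last one hold for the axis coefficients: they are the recursive
  definition of the harmonic curvatures, solved for the derivative.
\<close>

lemma arc_deriv_axis_coeff:
  assumes "1 \<le> i" "i < n" "t \<in> I"
  shows "D (axis_coeff i) t = K i t * axis_coeff (i + 1) t - K (i - 1) t * axis_coeff (i - 1) t"
proof -
  consider "i = 1" | "i = 2" | j where "i = j + 3"
    using assms(1) by (metis One_nat_def Suc_1 add.commute le_Suc_ex not_less_eq_eq numeral_3_eq_3 le_antisym)
  then show ?thesis
  proof cases
    case 1
    then show ?thesis by (simp add: axis_coeff_def K_def arc_deriv_const)
  next
    case 2
    then show ?thesis
      using assms k_nonzero[of 2 t] by (simp add: axis_coeff_def K_def arc_deriv_const)
  next
    case (3 j)
    then have "k (j + 3) t \<noteq> 0"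
      using assms k_nonzero[of "j + 3" t] by simp
    moreover have "j + 3 + 1 - 2 = Suc (Suc j)" "j + 3 - 2 = Suc j" "j + 3 - 1 - 2 = j"
      by simp_all
    ultimately show ?thesis
      using assms 3 by (simp add: axis_coeff_def K_def field_simps)
  qed
qed

lemma frenet_system_axis_coeff_iff_last:
  "frenet_system axis_coeff
    \<longleftrightarrow> (\<forall>t\<in>I. D (axis_coeff n) t = - (k (n - 1) t * axis_coeff (n - 1) t))" (is "?l \<longleftrightarrow> ?r")
proof
  assume ?l
  then show ?r
    using dim by (simp add: frenet_system_def K_simps del: One_nat_def)
next
  assume ?r
  show ?l
    unfolding frenet_system_def
  proof (intro ballI)
    fix i t assume "i \<in> {1..n}" "t \<in> I"
    show "D (axis_coeff i) t = K i t * axis_coeff (i + 1) t - K (i - 1) t * axis_coeff (i - 1) t"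
    proof (cases "i = n")
      case True
      then show ?thesis
        using \<open>?r\<close> \<open>t \<in> I\<close> by (simp add: K_simps del: One_nat_def)
    next
      case False
      then show ?thesis
        using \<open>i \<in> {1..n}\<close> \<open>t \<in> I\<close> by (intro arc_deriv_axis_coeff) auto
    qed
  qed
qed

lemma frenet_system_axis_coeff:
  "frenet_system axis_coeff \<longleftrightarrow> (\<forall>t\<in>I. D (H (n - 2)) t + k (n - 1) t * H (n - 3) t = 0)"
proof -
  have "axis_coeff n = H (n - 2)" "axis_coeff (n - 1) = H (n - 3)"
    using dim by (auto simp: axis_coeff_def numeral_3_eq_3)
  then show ?thesis
    unfolding frenet_system_axis_coeff_iff_last by (simp add: eq_neg_iff_add_eq_0)
qed

text \<open>
  The first component determines a solution: the \<open>i\<close>-th equation can be solved for the component \<open>i + 1\<close>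
  because the \<open>i\<close>-th curvature does not vanish.
\<close>

lemma frenet_system_unique:
  assumes sys: "frenet_system b" and b1: "\<And>t. t \<in> I \<Longrightarrow> b 1 t = c"
  shows "i \<in> {1..n} \<Longrightarrow> t \<in> I \<Longrightarrow> b i t = c * axis_coeff i t"
proof (induction i arbitrary: t rule: less_induct)
  case (less i)
  show ?case
  proof (cases "i = 1")
    case True
    then show ?thesis using b1 less.prems by (simp add: axis_coeff_def)
  next
    case False
    define j where "j = i - 1"
    have j: "i = j + 1" "1 \<le> j" "j < n"
      using False less.prems by (auto simp: j_def)
    have "D (b j) t = D (\<lambda>s. c * axis_coeff j s) t"
      using less.IH[of j] j less.prems(2) by (intro arc_deriv_cong) auto
    then have D: "D (b j) t = c * D (axis_coeff j) t"
      using arc_deriv_cmult smooth_axis_coeff j less.prems(2) by simp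
    have pred: "K (j - 1) t * b (j - 1) t = c * (K (j - 1) t * axis_coeff (j - 1) t)"
    proof (cases "j = 1")
      case True
      then show ?thesis by (simp add: K_def)
    next
      case False
      then show ?thesis using less.IH[of "j - 1"] j less.prems(2) by simp
    qed
    have "K j t * b i t - K (j - 1) t * b (j - 1) t = c * D (axis_coeff j) t"
      using sys j less.prems(2) D by (simp add: frenet_system_def)
    also have "\<dots> = K j t * (c * axis_coeff i t) - c * (K (j - 1) t * axis_coeff (j - 1) t)"
      unfolding arc_deriv_axis_coeff[OF j(2,3) less.prems(2)] j(1)
      by (simp add: right_diff_distrib mult.left_commute)
    finally have "K j t * b i t = K j t * (c * axis_coeff i t)"
      using pred by linarith
    moreover have "K j t \<noteq> 0"
      using j less.prems(2) k_nonzero[of j t] by (simp add: K_def)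
    ultimately show ?thesis
      by simp
  qed
qed

lemma frenet_system_scale:
  assumes "\<And>i. i \<in> {1..n} \<Longrightarrow> smooth_on (a i) I" "frenet_system a"
  shows "frenet_system (\<lambda>i t. c * a i t)"
  using assms(2) by (simp add: frenet_system_def arc_deriv_cmult assms(1) right_diff_distrib mult.left_commute)

lemma inner_prod_unit_tangent: "t \<in> I \<Longrightarrow> inner_prod (unit_tangent M \<alpha>) X t = inner_prod (v 1) X t"
  using selected_chart[of t] tangent by metis

text \<open>
  By the product rule, a parallel field contributes nothing to the derivative of its product with
  \<open>v i\<close>, so only the Frenet equation of \<open>v i\<close> enters.
\<close>

lemma frenet_system_inner_prod:
  assumes "field X" "LC_parallel M I \<alpha> X"
  shows "frenet_system (\<lambda>i. inner_prod (v i) X)"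
  unfolding frenet_system_def
proof (intro ballI)
  fix i t assume i: "i \<in> {1..n}" and t: "t \<in> I"
  obtain \<phi> where \<phi>: "\<phi> \<in> atlas M" "\<alpha> t \<in> chart_dom \<phi>"
    "\<And>X Y. inner_prod X Y t = inner_at M \<phi> (\<alpha> t) (X \<phi> t) (Y \<phi> t)"
    using selected_chart[OF t] by blast
  show "D (inner_prod (v i) X) t = K i t * inner_prod (v (i + 1)) X t - K (i - 1) t * inner_prod (v (i - 1)) X t"
    using arc_deriv_inner_prod[OF field_v[OF i] assms(1) t] inner_prod_parallel(2)[OF assms(2) t]
    by (simp add: \<phi>(3) frenet[OF i \<phi>(1) t \<phi>(2)] inner_at_simps)
qed

lemma frame_complete:
  assumes "t \<in> I" "\<And>i. i \<in> {1..n} \<Longrightarrow> inner_prod (v i) X t = 0"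
  shows "inner_prod X X t = 0"
proof -
  obtain \<phi> where \<phi>: "\<And>X Y. inner_prod X Y t = inner_at M \<phi> (\<alpha> t) (X \<phi> t) (Y \<phi> t)"
    using selected_chart[OF assms(1)] by blast
  show ?thesis
    unfolding \<phi> by (rule orthonormal_frame_complete[of M \<phi> "\<alpha> t" "\<lambda>i. v i \<phi> t"])
      (use assms orthonormal in \<open>simp_all add: \<phi>[symmetric] n_eq[symmetric]\<close>)
qed

section \<open>Helices and harmonic curvatures\<close>

lemma LC_helix_imp_frenet_system:
  assumes "LC_helix M I \<alpha>" "I \<noteq> {}"
  shows "frenet_system axis_coeff"
proof -
  obtain X \<theta> where X: "field X" "\<And>t. t \<in> I \<Longrightarrow> inner_prod X X t = 1" "LC_parallel M I \<alpha> X"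
    "\<And>t. t \<in> I \<Longrightarrow> inner_prod (v 1) X t = cos \<theta>"
    using assms(1) inner_prod_unit_tangent unfolding LC_helix_def by metis
  define b where "b i = inner_prod (v i) X" for i
  have sys: "frenet_system b"
    using frenet_system_inner_prod[OF X(1,3)] by (simp add: b_def[abs_def])
  have b: "b i t = cos \<theta> * axis_coeff i t" if "i \<in> {1..n}" "t \<in> I" for i t
    by (rule frenet_system_unique[OF sys _ that]) (use X(4) in \<open>simp add: b_def\<close>)
  \<comment> \<open>If the cosine were zero, the axis would be orthogonal to the whole frame.\<close>
  have "cos \<theta> \<noteq> 0"
  proof
    assume "cos \<theta> = 0"
    moreover obtain t where "t \<in> I"
      using assms(2) by blast
    ultimately show False
      using frame_complete[of t X] X(2)[of t] b by (simp add: b_def)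
  qed
  have "D (axis_coeff n) t = - (k (n - 1) t * axis_coeff (n - 1) t)" if t: "t \<in> I" for t
  proof -
    have n: "n \<in> {1..n}" "n - 1 \<in> {1..n}"
      using dim by auto
    have "D (b n) t = D (\<lambda>s. cos \<theta> * axis_coeff n s) t"
      using b[OF n(1)] t by (rule arc_deriv_cong)
    also have "\<dots> = cos \<theta> * D (axis_coeff n) t"
      using arc_deriv_cmult smooth_axis_coeff[OF n(1)] t by simp
    finally have "cos \<theta> * D (axis_coeff n) t = D (b n) t" ..
    also have "\<dots> = - (k (n - 1) t * b (n - 1) t)"
      using sys n t by (simp add: frenet_system_def K_simps del: One_nat_def)
    also have "\<dots> = cos \<theta> * - (k (n - 1) t * axis_coeff (n - 1) t)"
      using b[OF n(2) t] by simp
    finally show ?thesis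
      by (simp only: mult_left_cancel[OF \<open>cos \<theta> \<noteq> 0\<close>])
  qed
  then show ?thesis
    unfolding frenet_system_axis_coeff_iff_last by blast
qed

text \<open>
  The combination of the frame with the axis coefficients is parallel, so its squared length \<open>N\<close>
  is constant. Dividing by \<open>sqrt N\<close> gives an axis whose angle has cosine \<open>1 / sqrt N\<close>.
\<close>

lemma frenet_system_imp_LC_helix:
  assumes sys: "frenet_system axis_coeff" and "I \<noteq> {}"
  shows "LC_helix M I \<alpha>"
proof -
  obtain N where N: "(\<Sum>i\<in>{1..n}. (axis_coeff i t)\<^sup>2) = N" if "t \<in> I" for t
    using inner_prod_parallel_const[OF field_combination LC_parallel_combination, of axis_coeff]
      smooth_axis_coeff sys inner_prod_combination by auto
  obtain s where "s \<in> I"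
    using assms(2) by blast
  \<comment> \<open>The first coefficient already contributes \<open>1\<close>, so that \<open>1 / sqrt N\<close> is a cosine.\<close>
  have "1 = (axis_coeff 1 s)\<^sup>2"
    by (simp add: axis_coeff_def)
  also have "\<dots> \<le> N"
    unfolding N[OF \<open>s \<in> I\<close>, symmetric] using dim by (intro member_le_sum) auto
  finally have "N \<ge> 1" .
  define r where "r = 1 / sqrt N"
  have r: "\<bar>r\<bar> \<le> 1" "r\<^sup>2 * N = 1"
    using \<open>N \<ge> 1\<close> by (simp_all add: r_def power_divide)
  define X where "X = combination (\<lambda>i t. r * axis_coeff i t)"
  have smooth: "smooth_on (\<lambda>t. r * axis_coeff i t) I" if "i \<in> {1..n}" for i
    using smooth_axis_coeff[OF that] by (intro smooth_on_mult smooth_on_const open_I)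
  have "field X" "LC_parallel M I \<alpha> X"
    unfolding X_def
    using field_combination[of "\<lambda>i t. r * axis_coeff i t", OF smooth]
      LC_parallel_combination[of "\<lambda>i t. r * axis_coeff i t", OF smooth]
      frenet_system_scale[of axis_coeff, OF smooth_axis_coeff sys] by blast+
  moreover have "inner_prod X X t = 1" if "t \<in> I" for t
    using r(2) N[OF that] inner_prod_combination[OF that]
    by (simp add: X_def power_mult_distrib sum_distrib_left[symmetric])
  moreover have "inner_prod (unit_tangent M \<alpha>) X t = cos (arccos r)" if "t \<in> I" for t
    using inner_prod_v_combination[of 1 t] that dim r(1)
    by (simp add: inner_prod_unit_tangent X_def axis_coeff_def cos_arccos_abs)
  ultimately show ?thesis
    unfolding LC_helix_def by blast
qed

end

theorem theorem4:
  fixes M :: "('a, 'n::finite) riemannian" and c :: real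
    and I :: "real set" and \<alpha> :: "real \<Rightarrow> 'a"
    and v :: "nat \<Rightarrow> ('a, 'n) field_along" and k :: "nat \<Rightarrow> real \<Rightarrow> real"
  assumes "space_form M c" and "CARD('n) \<ge> 3"
    and "open I" and "is_interval I" and "I \<noteq> {}"
    and "regular_curve M I \<alpha> v k"
  shows "LC_helix M I \<alpha> \<longleftrightarrow>
    (\<forall>t\<in>I. arc_deriv M \<alpha> (harmonic_curvature M \<alpha> k (CARD('n) - 2)) t
       + k (CARD('n) - 1) t * harmonic_curvature M \<alpha> k (CARD('n) - 3) t = 0)"
proof -
  interpret frenet_curve M I \<alpha> v k "CARD('n)"
    using assms by unfold_locales (simp_all add: space_form_def)
  show ?thesis
    using LC_helix_imp_frenet_system frenet_system_imp_LC_helix \<open>I \<noteq> {}\<close> frenet_system_axis_coeff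
    by blast
qed

end
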